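(* Let $k$ be a field, $R=k[x_1,\ldots,x_n]$, and let $I\subseteq R$ be an almost complete intersection monomial ideal with minimal monomial generating set $G(I)=\{u_1,\ldots,u_q,u_{q+1}\}$, where $u_1,\ldots,u_q$ is a regular sequence. Put $I'=(u_1,\ldots,u_q)$. (1) Suppose there exists $2\le s\le q$ such that $u_{q+1}\mid \operatorname{lcm}(u_1,\ldots,u_s)$ and $u_{q+1}\nmid\operatorname{lcm}(\sigma)$ for every $\sigma\subset\{u_1,\ldots,u_s\}$ with $|\sigma|<s$. Then $$\operatorname{reg}(I)=\operatorname{reg}(I')-\min\left\{\deg\left(\frac{u_j}{\gcd(u_j,u_{q+1})}\right) : j=1,\ldots,s\right\}.$$ (2) Suppose $u_{q+1}$ does not divide $\operatorname{lcm}(\sigma)$ for any subset $\sigma$ of $G(I)\setminus\{u_{q+1}\}$, and that there exists $1\le h\le q$ such that, for $j\in\{1,\ldots,q\}$, $\operatorname{Supp}(u_j)\cap\operatorname{Supp}(u_{q+1})$ is nonempty exactly when $j\le h$. Then $$\operatorname{reg}(I)=\sum_{l=1}^{q+1}\deg(u_l)-q-\sum_{i=1}^{h}\deg\bigl(\gcd(u_i,u_{q+1})\bigr).$$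
   Context: $R=k[x_1,\ldots,x_n]$ is standard graded. For a monomial ideal $I$, $G(I)$ is its unique minimal set of monomial generators. A monomial ideal $I$ is an almost complete intersection if $G(I)=\{u_1,\ldots,u_q,u_{q+1}\}$ with $u_1,\ldots,u_q$ a regular sequence. $\operatorname{Supp}(u)$ is the set of variables dividing the monomial $u$. For a finitely generated graded $R$-module $M$, $\operatorname{reg}(M)=\max\{j-i:\beta_{i,j}(M)\ne 0\}$, where $\beta_{i,j}(M)=\dim_k\operatorname{Tor}_i^R(M,k)_j$ (Castelnuovo-Mumford regularity). *)

theory Defs
  imports Complex_Main "HOL-Library.Poly_Mapping" "HOL-Library.Function_Algebras"
begin

section \<open>Polynomials and monomials\<close>

text \<open>
  The variables are the elements of a finite type \<open>'n\<close>.  A monomial is its exponent vector, so the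
  product and exact quotient of monomials are \<open>+\<close> and \<open>-\<close>, the monomial \<open>1\<close> is \<open>0\<close>, and the support of
  \<open>u\<close> is \<^term>\<open>Poly_Mapping.keys u\<close>.  The multiplication of \<open>mpoly\<close> is the convolution product of Poly_Mapping.
  (The order that the library puts on \<^typ>\<open>'n \<Rightarrow>\<^sub>0 nat\<close> is lexicographic and has nothing to do with
  divisibility, which is expressed below by \<open>dvd\<close> in the polynomial ring.)
\<close>

type_synonym 'n monomial = "'n \<Rightarrow>\<^sub>0 nat"
type_synonym ('n, 'k) mpoly = "('n \<Rightarrow>\<^sub>0 nat) \<Rightarrow>\<^sub>0 'k"

definition mon :: "'n monomial \<Rightarrow> ('n, 'k::field) mpoly" where
  "mon u = Poly_Mapping.single u 1"

definition mdeg :: "'n::finite monomial \<Rightarrow> nat" where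
  "mdeg u = (\<Sum>x\<in>UNIV. Poly_Mapping.lookup u x)"

lift_definition mgcd :: "'n::finite monomial \<Rightarrow> 'n monomial \<Rightarrow> 'n monomial"
  is "\<lambda>u v x. min (u x) (v x)"
  by simp

text \<open>The least common multiple of a finite set of monomials; that of the empty set is \<open>1\<close>.\<close>

lift_definition mlcm :: "'n::finite monomial set \<Rightarrow> 'n monomial"
  is "\<lambda>S x. Max (insert 0 ((\<lambda>u. u x) ` S))"
  by simp

text \<open>\<open>0\<close> is homogeneous of every degree.  Degrees are integers so that they can be shifted.\<close>

definition homogeneous :: "int \<Rightarrow> ('n::finite, 'k::zero) mpoly \<Rightarrow> bool" where
  "homogeneous e p \<longleftrightarrow> (\<forall>t\<in>Poly_Mapping.keys p. int (mdeg t) = e)"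


section \<open>Ideals, regular sequences, almost complete intersections\<close>

definition ideal_of :: "'a::comm_ring_1 set \<Rightarrow> 'a set" where
  "ideal_of S = module.span (*) S"

definition regular_sequence :: "'a::comm_ring_1 list \<Rightarrow> bool" where
  "regular_sequence fs \<longleftrightarrow>
     (\<forall>i<length fs. \<forall>r. r * fs ! i \<in> ideal_of (set (take i fs)) \<longrightarrow> r \<in> ideal_of (set (take i fs)))
     \<and> ideal_of (set fs) \<noteq> UNIV"

text \<open>\<open>minimal_monomial_generators I G\<close> says that \<open>I\<close> is a monomial ideal and \<open>G = G(I)\<close>.\<close>

definition minimal_monomial_generators ::
    "('n, 'k::field) mpoly set \<Rightarrow> 'n monomial set \<Rightarrow> bool" where
  "minimal_monomial_generators I G \<longleftrightarrow>
     ideal_of (mon ` G) = I \<and> (\<forall>H. H \<subset> G \<longrightarrow> ideal_of (mon ` H) \<noteq> I)"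

definition almost_complete_intersection ::
    "('n, 'k::field) mpoly set \<Rightarrow> nat \<Rightarrow> (nat \<Rightarrow> 'n monomial) \<Rightarrow> bool" where
  "almost_complete_intersection I q u \<longleftrightarrow>
     inj_on u {1..q+1}
     \<and> minimal_monomial_generators I (u ` {1..q+1})
     \<and> regular_sequence (map (\<lambda>j. mon (u j) :: ('n, 'k) mpoly) [1..<q+1])"


section \<open>Graded free resolutions\<close>

text \<open>
  A complex of finitely generated graded free modules
  \<open>\<dots> \<rightarrow> F\<^sub>2 \<rightarrow> F\<^sub>1 \<rightarrow> F\<^sub>0\<close> together with an augmentation \<open>F\<^sub>0 \<rightarrow> M\<close>, given by bases: \<open>F\<^sub>i\<close> has basis
  \<open>e\<^sub>0, \<dots>, e\<^bsub>r-1\<^esub>\<close> with \<open>r = rk i\<close> and \<open>e\<^sub>b\<close> in degree \<open>bdeg i b\<close>; the coefficient at \<open>e\<^sub>c\<close> of the image of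
  \<open>e\<^sub>b \<in> F\<^bsub>i+1\<^esub>\<close> in \<open>F\<^sub>i\<close> is \<open>entry i c b\<close>; and \<open>e\<^sub>b \<in> F\<^sub>0\<close> is mapped to \<open>aug b\<close>.
\<close>

record ('r, 'm) free_complex =
  rk :: "nat \<Rightarrow> nat"
  bdeg :: "nat \<Rightarrow> nat \<Rightarrow> int"
  entry :: "nat \<Rightarrow> nat \<Rightarrow> nat \<Rightarrow> 'r"
  aug :: "nat \<Rightarrow> 'm"

definition mat_app :: "nat \<Rightarrow> nat \<Rightarrow> (nat \<Rightarrow> nat \<Rightarrow> 'a::comm_ring_1) \<Rightarrow> (nat \<Rightarrow> 'a) \<Rightarrow> nat \<Rightarrow> 'a" where
  "mat_app m r A f = (\<lambda>c. if c < m then \<Sum>b<r. A c b * f b else 0)"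

definition chain_module :: "(('n, 'k::field) mpoly, 'm) free_complex \<Rightarrow> nat \<Rightarrow> (nat \<Rightarrow> ('n, 'k) mpoly) set" where
  "chain_module F i = {f. \<forall>b\<ge>rk F i. f b = 0}"

definition differential :: "(('n, 'k::field) mpoly, 'm) free_complex \<Rightarrow> nat
    \<Rightarrow> (nat \<Rightarrow> ('n, 'k) mpoly) \<Rightarrow> nat \<Rightarrow> ('n, 'k) mpoly" where
  "differential F i = mat_app (rk F i) (rk F (Suc i)) (entry F i)"

definition augment :: "(('n, 'k::field) mpoly \<Rightarrow> 'm::ab_group_add \<Rightarrow> 'm)
    \<Rightarrow> (('n, 'k) mpoly, 'm) free_complex \<Rightarrow> (nat \<Rightarrow> ('n, 'k) mpoly) \<Rightarrow> 'm" where
  "augment scale F f = (\<Sum>b<rk F 0. scale (f b) (aug F b))"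

text \<open>
  In the following, a graded module over the polynomial ring is given by its scalar multiplication
  \<open>scale\<close>, its carrier \<open>M\<close> (a submodule of an ambient module) and the sets \<open>gr j\<close> with
  \<open>M\<^sub>j = M \<inter> gr j\<close>.
\<close>

definition graded_free_resolution :: "(('n::finite, 'k::field) mpoly \<Rightarrow> 'm::ab_group_add \<Rightarrow> 'm)
    \<Rightarrow> (int \<Rightarrow> 'm set) \<Rightarrow> 'm set \<Rightarrow> (('n, 'k) mpoly, 'm) free_complex \<Rightarrow> bool" where
  "graded_free_resolution scale gr M F \<longleftrightarrow>
     (\<forall>b<rk F 0. aug F b \<in> M \<inter> gr (bdeg F 0 b))
     \<and> (\<forall>i. \<forall>c<rk F i. \<forall>b<rk F (Suc i). homogeneous (bdeg F (Suc i) b - bdeg F i c) (entry F i c b))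
     \<and> augment scale F ` chain_module F 0 = M
     \<and> {f \<in> chain_module F 0. augment scale F f = 0} = differential F 0 ` chain_module F 1
     \<and> (\<forall>i. {f \<in> chain_module F (Suc i). differential F i f = 0}
             = differential F (Suc i) ` chain_module F (Suc (Suc i)))"


section \<open>Betti numbers and regularity\<close>

text \<open>
  For a graded free resolution \<open>F\<close> of \<open>M\<close>, \<open>Tor\<^sub>i(M, k)\<^sub>j\<close> is the homology of \<open>(F \<otimes> k)\<^sub>j\<close> at \<open>i\<close>.
  Here \<open>k\<close> is the quotient of the polynomial ring by the ideal of the variables, so \<open>F\<^sub>i \<otimes> k\<close> is the
  \<open>k\<close>-vector space on the basis of \<open>F\<^sub>i\<close>, and the matrix of \<open>F\<^bsub>i+1\<^esub> \<otimes> k \<rightarrow> F\<^sub>i \<otimes> k\<close> consists of the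
  constant terms of the entries of the differential.
\<close>

definition tensor_k :: "(('n, 'k::field) mpoly, 'm) free_complex \<Rightarrow> nat \<Rightarrow> int \<Rightarrow> (nat \<Rightarrow> 'k) set" where
  "tensor_k F i j = {v. \<forall>b. v b \<noteq> 0 \<longrightarrow> b < rk F i \<and> bdeg F i b = j}"

definition diff_k :: "(('n, 'k::field) mpoly, 'm) free_complex \<Rightarrow> nat \<Rightarrow> (nat \<Rightarrow> 'k) \<Rightarrow> nat \<Rightarrow> 'k" where
  "diff_k F i = mat_app (rk F i) (rk F (Suc i)) (\<lambda>c b. Poly_Mapping.lookup (entry F i c b) 0)"

definition tor_cycles :: "(('n, 'k::field) mpoly, 'm) free_complex \<Rightarrow> nat \<Rightarrow> int \<Rightarrow> (nat \<Rightarrow> 'k) set" where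
  "tor_cycles F i j = {v \<in> tensor_k F i j. \<forall>i'. i = Suc i' \<longrightarrow> diff_k F i' v = 0}"

definition tor_boundaries :: "(('n, 'k::field) mpoly, 'm) free_complex \<Rightarrow> nat \<Rightarrow> int \<Rightarrow> (nat \<Rightarrow> 'k) set" where
  "tor_boundaries F i j = diff_k F i ` tensor_k F (Suc i) j"

definition kdim :: "(nat \<Rightarrow> 'k::field) set \<Rightarrow> nat" where
  "kdim V = vector_space.dim (\<lambda>a v b. a * v b) V"

text \<open>
  The boundaries form a subspace of the finite-dimensional space of cycles, so that the difference
  of dimensions is the dimension of the homology.
\<close>

definition tor_dim :: "(('n, 'k::field) mpoly, 'm) free_complex \<Rightarrow> nat \<Rightarrow> int \<Rightarrow> nat" where
  "tor_dim F i j = kdim (tor_cycles F i j) - kdim (tor_boundaries F i j)"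

text \<open>
  As usual for derived functors, Tor is computed from some chosen resolution; the result does not
  depend on the choice.
\<close>

definition betti :: "(('n::finite, 'k::field) mpoly \<Rightarrow> 'm::ab_group_add \<Rightarrow> 'm)
    \<Rightarrow> (int \<Rightarrow> 'm set) \<Rightarrow> 'm set \<Rightarrow> nat \<Rightarrow> int \<Rightarrow> nat" where
  "betti scale gr M i j = tor_dim (SOME F. graded_free_resolution scale gr M F) i j"

definition regularity :: "(('n::finite, 'k::field) mpoly \<Rightarrow> 'm::ab_group_add \<Rightarrow> 'm)
    \<Rightarrow> (int \<Rightarrow> 'm set) \<Rightarrow> 'm set \<Rightarrow> int" where
  "regularity scale gr M = Max {j - int i | i j. betti scale gr M i j \<noteq> 0}"

text \<open>The regularity of a homogeneous ideal, as a graded module with the grading of the ring.\<close>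

definition reg :: "('n::finite, 'k::field) mpoly set \<Rightarrow> int" where
  "reg I = regularity (*) (\<lambda>j. {p. homogeneous j p}) I"

end

theory Submission
  imports Defs
begin

text \<open>
  The Betti numbers of \<open>I\<close> are read off the Taylor complex on \<open>G(I)\<close>, whose basis elements are the subsets
  \<open>\<tau>\<close> of the generators, of degree \<open>deg lcm(\<tau>)\<close>.  Modulo the variables, \<open>e(\<tau> \<union> {u})\<close> maps to \<open>\<plusminus>e(\<tau>)\<close> exactly
  if adding \<open>u\<close> does not change the lcm.  As \<open>u\<^sub>1, \<dots>, u\<^sub>q\<close> are pairwise coprime, only \<open>u\<^bsub>q+1\<^esub>\<close> can be
  redundant in this way: in case (1) exactly over the subsets containing \<open>u\<^sub>1, \<dots>, u\<^sub>s\<close>, in case (2) never.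
  So Tor has a basis consisting of the remaining subsets.  Enlarging a subset by a generator that changes
  the lcm does not decrease \<open>deg lcm(\<tau>) - |\<tau>|\<close>, so the maximum is attained at \<open>G(I)\<close> in case (2) and at
  \<open>G(I) - {u\<^sub>j}\<close> for some \<open>j \<le> s\<close> in case (1).
\<close>


section \<open>Matrices acting on vectors\<close>

text \<open>\<open>betti\<close> is read from a resolution picked by \<open>SOME\<close>, about
  which nothing is known except that it is one. So the Taylor complex has to be proved exact, and
  its Tor has to be compared with that of an unknown resolution. As \<open>regularity\<close> asks
  only which Betti numbers are nonzero, the comparison carries over the inclusion of Tor cycles in
  Tor boundaries, not a dimension. The constant in case (1) arises as follows. A surviving subset
  misses some u_j with j \<le> s and so lies in G(I) - {u_j}. That set still contains u_{q+1}, so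
  putting u_j back raises the degree of the lcm only by deg(u_j / gcd(u_j, u_{q+1})), and the full
  lcm equals lcm(u_1, ..., u_q). Both G(I) - {u_j} and G(I') have q elements, which makes this
  degree exactly the loss against reg(I').\<close>

definition vecs :: "nat \<Rightarrow> (nat \<Rightarrow> 'a::zero) set" where
  "vecs n = {f. \<forall>b\<ge>n. f b = 0}"

definition unit_vec :: "nat \<Rightarrow> nat \<Rightarrow> 'a::zero_neq_one" where
  "unit_vec b = (\<lambda>c. if c = b then 1 else 0)"

definition mat_mul :: "nat \<Rightarrow> (nat \<Rightarrow> nat \<Rightarrow> 'a::comm_ring_1) \<Rightarrow> (nat \<Rightarrow> nat \<Rightarrow> 'a) \<Rightarrow> nat \<Rightarrow> nat \<Rightarrow> 'a" where
  "mat_mul p A B = (\<lambda>c b. \<Sum>k<p. A c k * B k b)"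

definition mat_one :: "nat \<Rightarrow> nat \<Rightarrow> 'a::zero_neq_one" where
  "mat_one = (\<lambda>c b. if c = b then 1 else 0)"

lemma mat_app_in_vecs [simp]: "mat_app m n A f \<in> vecs m"
  by (simp add: mat_app_def vecs_def)

lemma mat_app_mul: "mat_app m p A (mat_app p n B f) = mat_app m n (mat_mul p A B) f"
proof
  fix c
  have "(\<Sum>k<p. A c k * (\<Sum>b<n. B k b * f b)) = (\<Sum>b<n. (\<Sum>k<p. A c k * B k b) * f b)"
    by (simp add: sum_distrib_left sum_distrib_right sum.swap[of _ "{..<n}"] mult.assoc)
  then show "mat_app m p A (mat_app p n B f) c = mat_app m n (mat_mul p A B) f c"
    by (simp add: mat_app_def mat_mul_def)
qed

lemma mat_app_add: "mat_app m n A (f + g) = mat_app m n A f + mat_app m n A g"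
  by (auto simp: mat_app_def fun_eq_iff distrib_left sum.distrib)

lemma mat_app_diff: "mat_app m n A (f - g) = mat_app m n A f - mat_app m n A g"
  by (auto simp: mat_app_def fun_eq_iff right_diff_distrib sum_subtractf)

lemma mat_app_zero [simp]: "mat_app m n A 0 = 0"
  by (auto simp: mat_app_def fun_eq_iff)

lemma mat_app_scale: "mat_app m n A (\<lambda>b. a * f b) = (\<lambda>c. a * mat_app m n A f c)"
  by (auto simp: mat_app_def fun_eq_iff sum_distrib_left mult.left_commute)

lemma mat_app_diff_left: "mat_app m n (\<lambda>c b. A c b - B c b) f = mat_app m n A f - mat_app m n B f"
  by (auto simp: mat_app_def fun_eq_iff left_diff_distrib sum_subtractf)

lemma mat_app_one: "f \<in> vecs n \<Longrightarrow> mat_app n n mat_one f = f"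
  by (auto simp: mat_app_def mat_one_def vecs_def fun_eq_iff if_distrib[of "\<lambda>x. x * _"] cong: if_cong)

lemma mat_app_unit_vec: "b < n \<Longrightarrow> mat_app m n A (unit_vec b) = (\<lambda>c. if c < m then A c b else 0)"
  by (auto simp: mat_app_def unit_vec_def fun_eq_iff if_distrib[of "\<lambda>x. _ * x"] cong: if_cong)

lemma unit_vec_in_vecs: "b < n \<Longrightarrow> unit_vec b \<in> vecs n"
  by (auto simp: unit_vec_def vecs_def)


section \<open>Monomials and homogeneous polynomials\<close>

lemma mdeg_add: "mdeg (s + t) = mdeg s + mdeg t"
  by (simp add: mdeg_def lookup_add sum.distrib)

lemma mdeg_eq_0_iff [simp]: "mdeg t = 0 \<longleftrightarrow> t = 0"
  by (auto simp: mdeg_def poly_mapping_eq_iff fun_eq_iff)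

lemma monomial_add_eq_0_iff: "s + t = 0 \<longleftrightarrow> s = 0 \<and> t = (0 :: 'n \<Rightarrow>\<^sub>0 nat)"
  by (auto simp: poly_mapping_eq_iff fun_eq_iff lookup_add)

lemma homogeneous_zero [simp]: "homogeneous e 0"
  by (simp add: homogeneous_def)

lemma homogeneous_one [simp]: "homogeneous 0 (1 :: ('n::finite, 'k::field) mpoly)"
  by (simp add: homogeneous_def)

lemma homogeneous_iff_lookup:
  "homogeneous e p \<longleftrightarrow> (\<forall>t. Poly_Mapping.lookup p t \<noteq> 0 \<longrightarrow> int (mdeg t) = e)"
  by (auto simp: homogeneous_def in_keys_iff)

lemma homogeneous_diff:
  fixes p q :: "('n::finite, 'k::field) mpoly"
  shows "homogeneous e p \<Longrightarrow> homogeneous e q \<Longrightarrow> homogeneous e (p - q)"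
  unfolding homogeneous_iff_lookup lookup_minus by (metis diff_self)

lemma homogeneous_add:
  fixes p q :: "('n::finite, 'k::field) mpoly"
  shows "homogeneous e p \<Longrightarrow> homogeneous e q \<Longrightarrow> homogeneous e (p + q)"
  unfolding homogeneous_iff_lookup lookup_add by (metis add_0)

lemma homogeneous_sum:
  fixes f :: "'b \<Rightarrow> ('n::finite, 'k::field) mpoly"
  shows "(\<And>x. x \<in> S \<Longrightarrow> homogeneous e (f x)) \<Longrightarrow> homogeneous e (sum f S)"
  by (induction S rule: infinite_finite_induct) (auto intro: homogeneous_add)

lemma homogeneous_mult:
  fixes p q :: "('n::finite, 'k::field) mpoly"
  assumes "homogeneous d p" "homogeneous e q"
  shows "homogeneous (d + e) (p * q)"
  using assms keys_mult[of p q] by (fastforce simp: homogeneous_def mdeg_add)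

section \<open>Homogeneous components\<close>

lift_definition hom_comp :: "int \<Rightarrow> ('n::finite, 'k::field) mpoly \<Rightarrow> ('n, 'k) mpoly"
  is "\<lambda>e p t. if int (mdeg t) = e then p t else 0"
  by (auto elim: rev_finite_subset)

lemma homogeneous_hom_comp [simp]: "homogeneous e (hom_comp e p)"
  by (simp add: homogeneous_iff_lookup hom_comp.rep_eq)

lemma hom_comp_id: "homogeneous e p \<Longrightarrow> hom_comp e p = p"
  by (rule poly_mapping_eqI) (auto simp: homogeneous_iff_lookup hom_comp.rep_eq)

lemma hom_comp_zero [simp]: "hom_comp e 0 = 0"
  by (rule poly_mapping_eqI) (simp add: hom_comp.rep_eq)

lemma hom_comp_add: "hom_comp e (p + q) = hom_comp e p + hom_comp e q"
  by (rule poly_mapping_eqI) (simp add: hom_comp.rep_eq lookup_add)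

lemma hom_comp_sum: "hom_comp e (sum f S) = (\<Sum>x\<in>S. hom_comp e (f x))"
  by (induction S rule: infinite_finite_induct) (auto simp: hom_comp_add)

text \<open>In the convolution only terms l of \<open>a\<close> with degree d contribute, and then t
  = l + s has degree e exactly when s has degree e - d.\<close>

lemma hom_comp_mult:
  assumes "homogeneous d a"
  shows "hom_comp e (a * p) = a * hom_comp (e - d) p"
proof (rule poly_mapping_eqI)
  fix t
  have deg: "int (mdeg l) = d" if "Poly_Mapping.lookup a l \<noteq> 0" for l
    using assms that by (simp add: homogeneous_iff_lookup)
  have "Poly_Mapping.lookup a l * Sum_any (\<lambda>s. Poly_Mapping.lookup (hom_comp (e - d) p) s when t = l + s)
      = (if int (mdeg t) = e then Poly_Mapping.lookup a l * Sum_any (\<lambda>s. Poly_Mapping.lookup p s when t = l + s) else 0)"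
    for l
  proof (cases "Poly_Mapping.lookup a l = 0")
    case False
    have *: "(Poly_Mapping.lookup (hom_comp (e - d) p) s when t = l + s)
        = (if int (mdeg t) = e then (Poly_Mapping.lookup p s when t = l + s) else 0)" for s
      using deg[OF False] by (auto simp: when_def hom_comp.rep_eq mdeg_add)
    show ?thesis unfolding * by simp
  qed simp
  then show "Poly_Mapping.lookup (hom_comp e (a * p)) t = Poly_Mapping.lookup (a * hom_comp (e - d) p) t"
    by (simp add: hom_comp.rep_eq lookup_mult)
qed

text \<open>The exponent vector 0 decomposes only as 0 + 0. Hence taking constant terms is the ring
  homomorphism from R to k.\<close>

lemma const_term_mult:
  fixes p q :: "('n, 'k::field) mpoly"
  shows "Poly_Mapping.lookup (p * q) 0 = Poly_Mapping.lookup p 0 * Poly_Mapping.lookup q 0"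
proof -
  have *: "(Poly_Mapping.lookup q s when 0 = l + s) = ((Poly_Mapping.lookup q s when s = 0) when l = 0)" for l s
    by (auto simp: when_def monomial_add_eq_0_iff dest: sym)
  have "Poly_Mapping.lookup p l * Sum_any (\<lambda>s. Poly_Mapping.lookup q s when 0 = l + s)
     = (Poly_Mapping.lookup p l * Poly_Mapping.lookup q 0 when l = 0)" for l
    unfolding * by (auto simp: when_def)
  then show ?thesis by (simp add: lookup_mult)
qed

lemma const_term_homogeneous:
  "homogeneous e p \<Longrightarrow> Poly_Mapping.lookup p 0 \<noteq> 0 \<Longrightarrow> e = 0"
  by (auto simp: homogeneous_iff_lookup)

section \<open>Reduction of matrices and vectors modulo the variables\<close>

definition const_mat :: "(nat \<Rightarrow> nat \<Rightarrow> ('n, 'k::field) mpoly) \<Rightarrow> nat \<Rightarrow> nat \<Rightarrow> 'k" where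
  "const_mat A = (\<lambda>c b. Poly_Mapping.lookup (A c b) 0)"

definition const_vec :: "(nat \<Rightarrow> ('n, 'k::field) mpoly) \<Rightarrow> nat \<Rightarrow> 'k" where
  "const_vec f = (\<lambda>b. Poly_Mapping.lookup (f b) 0)"

definition of_const_vec :: "(nat \<Rightarrow> 'k) \<Rightarrow> nat \<Rightarrow> ('n, 'k::field) mpoly" where
  "of_const_vec v = (\<lambda>b. Poly_Mapping.single 0 (v b))"

lemma const_vec_of_const_vec [simp]: "const_vec (of_const_vec v) = v"
  by (simp add: const_vec_def of_const_vec_def)

lemma of_const_vec_in_vecs_iff [simp]:
  "(of_const_vec v :: nat \<Rightarrow> ('n, 'k::field) mpoly) \<in> vecs n \<longleftrightarrow> v \<in> vecs n"
proof -
  have "Poly_Mapping.single 0 a = (0 :: ('n, 'k) mpoly) \<longleftrightarrow> a = 0" for a :: 'k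
    by (metis lookup_single_eq lookup_zero single_zero)
  then show ?thesis by (simp add: vecs_def of_const_vec_def)
qed

lemma const_vec_mat_app: "const_vec (mat_app m n A f) = mat_app m n (const_mat A) (const_vec f)"
  by (auto simp: const_vec_def mat_app_def const_mat_def fun_eq_iff lookup_sum const_term_mult)

lemma const_vec_diff: "const_vec (f - g) = const_vec f - const_vec g"
  by (auto simp: const_vec_def lookup_minus)

lemma const_vec_zero [simp]: "const_vec 0 = 0"
  by (auto simp: const_vec_def)


section \<open>Comparison of graded resolutions\<close>

text \<open>Matrices of degree-preserving maps between graded free modules with basis degrees
  \<open>dn\<close> (source) and \<open>dm\<close> (target).\<close>

definition graded_mat :: "nat \<Rightarrow> nat \<Rightarrow> (nat \<Rightarrow> int) \<Rightarrow> (nat \<Rightarrow> int) \<Rightarrow> (nat \<Rightarrow> nat \<Rightarrow> ('n::finite, 'k::field) mpoly) \<Rightarrow> bool" where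
  "graded_mat m n dm dn A \<longleftrightarrow> (\<forall>c<m. \<forall>b<n. homogeneous (dn b - dm c) (A c b))"

lemma graded_mat_mul:
  assumes "graded_mat m p dm dp A" "graded_mat p n dp dn B"
  shows "graded_mat m n dm dn (mat_mul p A B)"
  unfolding graded_mat_def mat_mul_def
proof (intro allI impI homogeneous_sum)
  fix c b k assume "c < m" "b < n" "k \<in> {..<p}"
  then have "homogeneous ((dp k - dm c) + (dn b - dp k)) (A c k * B k b)"
    using assms by (intro homogeneous_mult) (auto simp: graded_mat_def)
  then show "homogeneous (dn b - dm c) (A c k * B k b)" by simp
qed

lemma graded_mat_one: "graded_mat n n d d mat_one"
  by (simp add: graded_mat_def mat_one_def)

lemma graded_mat_diff:
  "graded_mat m n dm dn A \<Longrightarrow> graded_mat m n dm dn B \<Longrightarrow> graded_mat m n dm dn (\<lambda>c b. A c b - B c b)"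
  by (simp add: graded_mat_def homogeneous_diff)

text \<open>Cutting coordinate b of an arbitrary preimage down to degree e - dn b commutes with a
  graded matrix, so the cut vector still maps to the homogeneous vector \<open>f\<close>.\<close>

lemma homogeneous_preimage:
  assumes A: "graded_mat m n dm dn A"
    and f: "\<And>c. c < m \<Longrightarrow> homogeneous (e - dm c) (f c)" "f \<in> mat_app m n A ` vecs n"
  obtains g where "g \<in> vecs n" "\<And>b. b < n \<Longrightarrow> homogeneous (e - dn b) (g b)" "mat_app m n A g = f"
proof -
  obtain g0 where g0: "f = mat_app m n A g0" "g0 \<in> vecs n" using f(2) by blast
  define g where "g = (\<lambda>b. hom_comp (e - dn b) (g0 b))"
  have "mat_app m n A g c = f c" for c
  proof (cases "c < m")
    case True
    have "f c = hom_comp (e - dm c) (f c)"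
      using f(1)[OF True] by (simp add: hom_comp_id)
    also have "\<dots> = (\<Sum>b<n. hom_comp (e - dm c) (A c b * g0 b))"
      using True by (simp add: g0(1) mat_app_def hom_comp_sum)
    also have "\<dots> = (\<Sum>b<n. A c b * g b)"
    proof (rule sum.cong)
      fix b assume "b \<in> {..<n}"
      then have "homogeneous (dn b - dm c) (A c b)" using A True by (simp add: graded_mat_def)
      then have "hom_comp (e - dm c) (A c b * g0 b) = A c b * hom_comp ((e - dm c) - (dn b - dm c)) (g0 b)"
        by (rule hom_comp_mult)
      then show "hom_comp (e - dm c) (A c b * g0 b) = A c b * g b" by (simp add: g_def)
    qed simp
    finally show ?thesis using True by (simp add: mat_app_def)
  next
    case False
    then show ?thesis by (simp add: mat_app_def g0(1))
  qed
  moreover have "g \<in> vecs n" using g0(2) by (auto simp: vecs_def g_def)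
  ultimately show ?thesis using that[of g] by (auto simp: g_def)
qed

text \<open>Projectivity of graded free modules: the columns of \<open>B\<close> are homogeneous
  preimages of the images of the basis vectors.\<close>

lemma matrix_lift:
  fixes D :: "nat \<Rightarrow> nat \<Rightarrow> ('n::finite, 'k::field) mpoly"
  assumes D: "graded_mat m p dm dp D" and A: "graded_mat m n dm dn A"
    and im: "\<And>f. f \<in> vecs n \<Longrightarrow> mat_app m n A f \<in> mat_app m p D ` vecs p"
  obtains B where "graded_mat p n dp dn B" "\<And>f. mat_app m p D (mat_app p n B f) = mat_app m n A f"
proof -
  have "\<exists>g. g \<in> vecs p \<and> (\<forall>k<p. homogeneous (dn b - dp k) (g k))
      \<and> mat_app m p D g = mat_app m n A (unit_vec b)" if b: "b < n" for b
  proof -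
    have "homogeneous (dn b - dm c) (mat_app m n A (unit_vec b) c)" if "c < m" for c
      using A b that by (simp add: mat_app_unit_vec graded_mat_def)
    then show ?thesis
      using homogeneous_preimage[OF D _ im[OF unit_vec_in_vecs[OF b]], of "dn b"] by metis
  qed
  then obtain g where g: "\<And>b k. b < n \<Longrightarrow> k < p \<Longrightarrow> homogeneous (dn b - dp k) (g b k)"
      "\<And>b. b < n \<Longrightarrow> mat_app m p D (g b) = mat_app m n A (unit_vec b)"
    by metis
  define B where "B = (\<lambda>k b. g b k)"
  have "mat_mul p D B c b = A c b" if "c < m" "b < n" for c b
    using g(2)[OF that(2), THEN fun_cong, of c] that
    by (simp add: mat_app_def[of m p] mat_app_unit_vec mat_mul_def B_def)
  then have "mat_app m p D (mat_app p n B f) = mat_app m n A f" for f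
    unfolding mat_app_mul by (simp add: mat_app_def cong: if_cong)
  then show ?thesis using that[of B] g(1) by (simp add: graded_mat_def B_def)
qed

text \<open>
  A resolution of the ideal \<open>I\<close>, augmented by the ring itself in position \<open>0\<close>, so that \<open>D 0\<close> is the row of
  generators and \<open>D (Suc i)\<close> is the \<open>i\<close>-th differential.
\<close>

definition augmented_resolution where
  "augmented_resolution I r d D \<longleftrightarrow>
     r 0 = 1 \<and> d 0 = (\<lambda>_. 0 :: int)
     \<and> (\<forall>i. graded_mat (r i) (r (Suc i)) (d i) (d (Suc i)) (D i))
     \<and> mat_app 1 (r 1) (D 0) ` vecs (r 1) = {f \<in> vecs 1. f 0 \<in> I}
     \<and> (\<forall>i. {f \<in> vecs (r (Suc i)). mat_app (r i) (r (Suc i)) (D i) f = 0}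
              = mat_app (r (Suc i)) (r (Suc (Suc i))) (D (Suc i)) ` vecs (r (Suc (Suc i))))"

lemma augmented_resolutionD:
  assumes "augmented_resolution I r d D"
  shows "r 0 = 1" "d 0 = (\<lambda>_. 0)"
    "graded_mat (r i) (r (Suc i)) (d i) (d (Suc i)) (D i)"
    "mat_app (r 0) (r (Suc 0)) (D 0) ` vecs (r (Suc 0)) = {f \<in> vecs (r 0). f 0 \<in> I}"
    "f \<in> vecs (r (Suc i)) \<Longrightarrow> mat_app (r i) (r (Suc i)) (D i) f = 0
       \<Longrightarrow> f \<in> mat_app (r (Suc i)) (r (Suc (Suc i))) (D (Suc i)) ` vecs (r (Suc (Suc i)))"
    "g \<in> vecs (r (Suc (Suc i)))
       \<Longrightarrow> mat_app (r i) (r (Suc i)) (D i) (mat_app (r (Suc i)) (r (Suc (Suc i))) (D (Suc i)) g) = 0"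
  using assms unfolding augmented_resolution_def One_nat_def by (blast | simp)+

text \<open>The comparison theorem, in graded form and over the identity of R in position 0.\<close>

lemma chain_map_exists:
  fixes D D' :: "nat \<Rightarrow> nat \<Rightarrow> nat \<Rightarrow> ('n::finite, 'k::field) mpoly"
  assumes R: "augmented_resolution I r d D" and R': "augmented_resolution I r' d' D'"
  obtains \<phi> where "\<phi> 0 = mat_one"
    "\<And>i. graded_mat (r' i) (r i) (d' i) (d i) (\<phi> i)"
    "\<And>i f. f \<in> vecs (r (Suc i)) \<Longrightarrow>
       mat_app (r' i) (r' (Suc i)) (D' i) (mat_app (r' (Suc i)) (r (Suc i)) (\<phi> (Suc i)) f)
         = mat_app (r' i) (r i) (\<phi> i) (mat_app (r i) (r (Suc i)) (D i) f)"
proof -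
  note a = augmented_resolutionD[OF R] and a' = augmented_resolutionD[OF R']
  \<comment> \<open>Besides the grading, \<open>P\<close> records that \<phi> D lands in the image
    of D', which is what the next lift requires; \<open>Q\<close> is the commuting square linking
    consecutive choices.\<close>
  define P where "P i \<phi> \<longleftrightarrow> (i = 0 \<longrightarrow> \<phi> = mat_one) \<and> graded_mat (r' i) (r i) (d' i) (d i) \<phi>
     \<and> (\<forall>f\<in>vecs (r (Suc i)). mat_app (r' i) (r i) \<phi> (mat_app (r i) (r (Suc i)) (D i) f)
           \<in> mat_app (r' i) (r' (Suc i)) (D' i) ` vecs (r' (Suc i)))" for i \<phi>
  define Q where "Q i \<phi> \<phi>' \<longleftrightarrow> (\<forall>f\<in>vecs (r (Suc i)).
       mat_app (r' i) (r' (Suc i)) (D' i) (mat_app (r' (Suc i)) (r (Suc i)) \<phi>' f)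
         = mat_app (r' i) (r i) \<phi> (mat_app (r i) (r (Suc i)) (D i) f))" for i \<phi> \<phi>'
  \<comment> \<open>Both complexes have R in position 0 and both rows of generators have image I, so
    the identity is a valid start.\<close>
  have "P 0 mat_one"
  proof -
    have "mat_app (r' 0) (r 0) mat_one f = f" if "f \<in> vecs (r 0)" for f :: "nat \<Rightarrow> ('n, 'k) mpoly"
      using mat_app_one[of f "r 0"] that a(1) a'(1) by simp
    moreover have "graded_mat (r' 0) (r 0) (d' 0) (d 0) mat_one"
      using graded_mat_one[of "r 0" "d 0"] a(1,2) a'(1,2) by simp
    ultimately show ?thesis unfolding P_def a'(4) using a(4) a(1) a'(1) by auto
  qed
  moreover have "\<exists>\<phi>'. P (Suc i) \<phi>' \<and> Q i \<phi> \<phi>'" if P: "P i \<phi>" for i \<phi>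
  proof -
    have g: "graded_mat (r' i) (r i) (d' i) (d i) \<phi>"
      and im: "\<And>f. f \<in> vecs (r (Suc i)) \<Longrightarrow> mat_app (r' i) (r (Suc i)) (mat_mul (r i) \<phi> (D i)) f
           \<in> mat_app (r' i) (r' (Suc i)) (D' i) ` vecs (r' (Suc i))"
      using P by (auto simp: P_def mat_app_mul)
    obtain B where B: "graded_mat (r' (Suc i)) (r (Suc i)) (d' (Suc i)) (d (Suc i)) B"
      "\<And>f. mat_app (r' i) (r' (Suc i)) (D' i) (mat_app (r' (Suc i)) (r (Suc i)) B f)
          = mat_app (r' i) (r (Suc i)) (mat_mul (r i) \<phi> (D i)) f"
      using matrix_lift[OF a'(3) graded_mat_mul[OF g a(3)] im] by blast
    have "mat_app (r' (Suc i)) (r (Suc i)) B (mat_app (r (Suc i)) (r (Suc (Suc i))) (D (Suc i)) f)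
           \<in> mat_app (r' (Suc i)) (r' (Suc (Suc i))) (D' (Suc i)) ` vecs (r' (Suc (Suc i)))"
      if "f \<in> vecs (r (Suc (Suc i)))" for f
      by (rule a'(5)) (simp_all add: B(2) mat_app_mul[symmetric] a(6)[OF that])
    then show ?thesis using B unfolding P_def Q_def by (auto simp: mat_app_mul)
  qed
  ultimately obtain \<phi> where "\<And>i. P i (\<phi> i)" "\<And>i. Q i (\<phi> i) (\<phi> (Suc i))"
    using dependent_nat_choice[of P Q] by blast
  then show ?thesis using that[of \<phi>] unfolding P_def Q_def by blast
qed

text \<open>A chain endomorphism that is the identity in position 0 is homotopic to the identity.
  The homotopy starts with 0, and at each stage exactness lifts the part of \<theta> - 1 that the
  previous stage leaves over.\<close>

lemma null_homotopy_exists: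
  fixes D :: "nat \<Rightarrow> nat \<Rightarrow> nat \<Rightarrow> ('n::finite, 'k::field) mpoly"
  assumes R: "augmented_resolution I r d D"
    and \<theta>: "\<And>f. f \<in> vecs (r 0) \<Longrightarrow> mat_app (r 0) (r 0) (\<theta> 0) f = f"
      "\<And>i. graded_mat (r i) (r i) (d i) (d i) (\<theta> i)"
      "\<And>i f. f \<in> vecs (r (Suc i)) \<Longrightarrow>
         mat_app (r i) (r (Suc i)) (D i) (mat_app (r (Suc i)) (r (Suc i)) (\<theta> (Suc i)) f)
           = mat_app (r i) (r i) (\<theta> i) (mat_app (r i) (r (Suc i)) (D i) f)"
  obtains h where "h 0 = (\<lambda>c b. 0)"
    "\<And>i. graded_mat (r (Suc i)) (r i) (d (Suc i)) (d i) (h i)"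
    "\<And>i f. f \<in> vecs (r (Suc i)) \<Longrightarrow>
       mat_app (r (Suc i)) (r (Suc (Suc i))) (D (Suc i)) (mat_app (r (Suc (Suc i))) (r (Suc i)) (h (Suc i)) f)
       = mat_app (r (Suc i)) (r (Suc i)) (\<theta> (Suc i)) f - f
         - mat_app (r (Suc i)) (r i) (h i) (mat_app (r i) (r (Suc i)) (D i) f)"
proof -
  note a = augmented_resolutionD[OF R]
  \<comment> \<open>The defect \<theta> - 1 - h D that the next homotopy matrix has to hit;
    \<open>P\<close> says that it is a cycle.\<close>
  define E where "E i h f = mat_app (r (Suc i)) (r (Suc i)) (\<theta> (Suc i)) f - f
         - mat_app (r (Suc i)) (r i) h (mat_app (r i) (r (Suc i)) (D i) f)" for i h and f :: "nat \<Rightarrow> ('n, 'k) mpoly"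
  define P where "P i h \<longleftrightarrow> (i = 0 \<longrightarrow> h = (\<lambda>c b. 0)) \<and> graded_mat (r (Suc i)) (r i) (d (Suc i)) (d i) h
     \<and> (\<forall>f\<in>vecs (r (Suc i)). mat_app (r i) (r (Suc i)) (D i) (E i h f) = 0)" for i h
  define Q where "Q i h h' \<longleftrightarrow> (\<forall>f\<in>vecs (r (Suc i)).
       mat_app (r (Suc i)) (r (Suc (Suc i))) (D (Suc i)) (mat_app (r (Suc (Suc i))) (r (Suc i)) h' f)
       = E i h f)" for i h h'
  have "P 0 (\<lambda>c b. 0)"
  proof -
    have "mat_app (r (Suc 0)) (r 0) (\<lambda>c b. 0) f = 0" for f :: "nat \<Rightarrow> ('n, 'k) mpoly"
      by (auto simp: mat_app_def)
    then show ?thesis by (simp add: P_def E_def graded_mat_def mat_app_diff \<theta>(1,3))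
  qed
  moreover have "\<exists>h'. P (Suc i) h' \<and> Q i h h'" if P: "P i h" for i h
  proof -
    \<comment> \<open>The defect written as a single graded matrix, so that
      \<open>matrix_lift\<close> applies to it.\<close>
    define A where "A = (\<lambda>c b. (\<theta> (Suc i) c b - mat_one c b) - mat_mul (r i) h (D i) c b)"
    have A: "mat_app (r (Suc i)) (r (Suc i)) A f = E i h f" if "f \<in> vecs (r (Suc i))" for f
      using that by (simp add: A_def E_def mat_app_diff_left mat_app_one mat_app_mul)
    have gA: "graded_mat (r (Suc i)) (r (Suc i)) (d (Suc i)) (d (Suc i)) A"
      unfolding A_def using P
      by (intro graded_mat_diff \<theta>(2) graded_mat_one graded_mat_mul[OF _ a(3)]) (simp add: P_def)
    have inv: "E i h f \<in> vecs (r (Suc i))" if "f \<in> vecs (r (Suc i))" for f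
      using A[OF that] mat_app_in_vecs by metis
    have im: "mat_app (r (Suc i)) (r (Suc i)) A f
        \<in> mat_app (r (Suc i)) (r (Suc (Suc i))) (D (Suc i)) ` vecs (r (Suc (Suc i)))"
      if f: "f \<in> vecs (r (Suc i))" for f
      unfolding A[OF f] using P f inv[OF f] by (intro a(5)) (auto simp: P_def)
    obtain B where B: "graded_mat (r (Suc (Suc i))) (r (Suc i)) (d (Suc (Suc i))) (d (Suc i)) B"
      "\<And>f. mat_app (r (Suc i)) (r (Suc (Suc i))) (D (Suc i)) (mat_app (r (Suc (Suc i))) (r (Suc i)) B f)
          = mat_app (r (Suc i)) (r (Suc i)) A f"
      using matrix_lift[OF a(3) gA im] by blast
    have "mat_app (r (Suc i)) (r (Suc (Suc i))) (D (Suc i)) (E (Suc i) B f) = 0"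
      if f: "f \<in> vecs (r (Suc (Suc i)))" for f
    proof -
      \<comment> \<open>With g = D f, the new defect is mapped to \<theta> g - g - E g, which is h
        (D g) = 0.\<close>
      let ?g = "mat_app (r (Suc i)) (r (Suc (Suc i))) (D (Suc i)) f"
      have "mat_app (r (Suc i)) (r (Suc (Suc i))) (D (Suc i)) (E (Suc i) B f)
          = mat_app (r (Suc i)) (r (Suc i)) (\<theta> (Suc i)) ?g - ?g - E i h ?g"
        by (simp add: E_def[of "Suc i"] mat_app_diff \<theta>(3)[OF f] B(2) A)
      then show ?thesis by (simp add: E_def a(6)[OF f])
    qed
    then show ?thesis using B A unfolding P_def Q_def by auto
  qed
  ultimately obtain h where "\<And>i. P i (h i)" "\<And>i. Q i (h i) (h (Suc i))"
    using dependent_nat_choice[of P Q] by blast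
  then show ?thesis using that[of h] unfolding P_def Q_def E_def by blast
qed


section \<open>Vanishing of Tor does not depend on the resolution\<close>

lemma all_nat_split: "(\<forall>i. P i) \<longleftrightarrow> P 0 \<and> (\<forall>i. P (Suc i))"
  by (metis not0_implies_Suc)

text \<open>F_i moves to position i + 1, and the augmentation becomes a matrix with one row.
  Exactness at F_0 then has the same form as exactness elsewhere, so later inductions need no
  separate treatment of it.\<close>

lemma augmented_resolution_of_free_complex:
  fixes F :: "(('n::finite, 'k::field) mpoly, ('n, 'k) mpoly) free_complex"
  assumes "graded_free_resolution (*) (\<lambda>j. {p. homogeneous j p}) I F"
  shows "augmented_resolution I (case_nat 1 (rk F)) (case_nat (\<lambda>_. 0) (bdeg F))
           (case_nat (\<lambda>c b. aug F b) (entry F))"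
proof -
  note F = assms[unfolded graded_free_resolution_def]
  have aug: "mat_app 1 (rk F 0) (\<lambda>c b. aug F b) f = (\<lambda>c. if c = 0 then augment (*) F f else 0)" for f
    by (auto simp: mat_app_def augment_def mult.commute)
  have chain: "chain_module F i = vecs (rk F i)" for i
    by (simp add: chain_module_def vecs_def)
  have diff: "differential F i = mat_app (rk F i) (rk F (Suc i)) (entry F i)" for i
    by (simp add: differential_def)
  have "mat_app 1 (rk F 0) (\<lambda>c b. aug F b) ` vecs (rk F 0) = {f \<in> vecs 1. f 0 \<in> I}"
  proof -
    have "I = augment (*) F ` vecs (rk F 0)" using F by (simp add: chain)
    then have "mat_app 1 (rk F 0) (\<lambda>c b. aug F b) ` vecs (rk F 0)
        = (\<lambda>p c. if c = 0 then p else 0) ` I"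
      unfolding aug by (auto simp: image_image)
    also have "\<dots> = {f \<in> vecs 1. f 0 \<in> I}"
    proof (rule set_eqI, rule iffI)
      fix f :: "nat \<Rightarrow> ('n, 'k) mpoly" assume "f \<in> {f \<in> vecs 1. f 0 \<in> I}"
      then have "f = (\<lambda>c. if c = 0 then f 0 else 0)" "f 0 \<in> I" by (auto simp: vecs_def)
      then show "f \<in> (\<lambda>p c. if c = 0 then p else 0) ` I" by blast
    qed (auto simp: vecs_def)
    finally show ?thesis .
  qed
  moreover have "graded_mat 1 (rk F 0) (\<lambda>_. 0) (bdeg F 0) (\<lambda>c b. aug F b)"
    using F by (auto simp: graded_mat_def)
  moreover have "graded_mat (rk F i) (rk F (Suc i)) (bdeg F i) (bdeg F (Suc i)) (entry F i)" for i
    using F by (auto simp: graded_mat_def)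
  moreover have "{f \<in> vecs (rk F 0). mat_app 1 (rk F 0) (\<lambda>c b. aug F b) f = 0}
      = mat_app (rk F 0) (rk F 1) (entry F 0) ` vecs (rk F 1)"
  proof -
    have "mat_app 1 (rk F 0) (\<lambda>c b. aug F b) f = 0 \<longleftrightarrow> augment (*) F f = 0" for f
      unfolding aug by (auto simp: fun_eq_iff)
    then show ?thesis using F by (simp add: chain diff)
  qed
  moreover have "{f \<in> vecs (rk F (Suc i)). mat_app (rk F i) (rk F (Suc i)) (entry F i) f = 0}
      = mat_app (rk F (Suc i)) (rk F (Suc (Suc i))) (entry F (Suc i)) ` vecs (rk F (Suc (Suc i)))" for i
    using F by (simp add: chain diff)
  ultimately show ?thesis
    unfolding augmented_resolution_def by (simp add: all_nat_split)
qed

text \<open>A homogeneous entry of nonzero degree has constant term 0, so a graded matrix reduced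
  modulo the variables connects only basis elements of equal degree.\<close>

lemma const_mat_graded:
  assumes "graded_mat m n dm dn A" "\<forall>b. v b \<noteq> 0 \<longrightarrow> b < n \<and> dn b = j"
  shows "\<forall>c. mat_app m n (const_mat A) v c \<noteq> 0 \<longrightarrow> c < m \<and> dm c = j"
proof (intro allI impI)
  fix c assume nz: "mat_app m n (const_mat A) v c \<noteq> 0"
  then have c: "c < m" by (auto simp: mat_app_def split: if_splits)
  with nz obtain b where "b < n" "const_mat A c b * v b \<noteq> 0"
    by (auto simp: mat_app_def elim: sum.not_neutral_contains_not_neutral)
  with assms c const_term_homogeneous[of "dn b - dm c" "A c b"] show "c < m \<and> dm c = j"
    by (auto simp: graded_mat_def const_mat_def)
qed

lemma tensor_k_in_vecs: "v \<in> tensor_k F i j \<Longrightarrow> v \<in> vecs (rk F i)"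
  unfolding tensor_k_def vecs_def by (simp, meson not_le)

lemma tensor_k_diff: "v \<in> tensor_k F i j \<Longrightarrow> w \<in> tensor_k F i j \<Longrightarrow> v - w \<in> tensor_k F i j"
  unfolding tensor_k_def by (simp, metis diff_self)

lemma tensor_k_add: "v \<in> tensor_k F i j \<Longrightarrow> w \<in> tensor_k F i j \<Longrightarrow> v + w \<in> tensor_k F i j"
  unfolding tensor_k_def by (simp, metis add_0)

lemma tor_boundaries_subset_cycles:
  fixes F :: "(('n::finite, 'k::field) mpoly, ('n, 'k) mpoly) free_complex"
  assumes F: "graded_free_resolution (*) (\<lambda>j. {p. homogeneous j p}) I F"
  shows "tor_boundaries F i j \<subseteq> tor_cycles F i j"
proof
  fix w assume "w \<in> tor_boundaries F i j"
  then obtain v where v: "v \<in> tensor_k F (Suc i) j" "w = diff_k F i v"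
    by (auto simp: tor_boundaries_def)
  have dk: "diff_k F i' = mat_app (rk F i') (rk F (Suc i')) (const_mat (entry F i'))" for i'
    by (simp add: diff_k_def const_mat_def)
  note a = augmented_resolutionD[OF augmented_resolution_of_free_complex[OF F]]
  have "w \<in> tensor_k F i j"
    using const_mat_graded[OF a(3)[of "Suc i"], of v j] v by (simp add: tensor_k_def dk)
  moreover have "diff_k F i' w = 0" if "i = Suc i'" for i'
  proof -
    \<comment> \<open>Regard v as a vector of constant polynomials: D D = 0 holds for it over R, and
      taking constant terms gives the identity modulo the variables.\<close>
    have "of_const_vec v \<in> vecs (rk F (Suc (Suc i')))"
      using tensor_k_in_vecs[OF v(1)] that by simp
    from arg_cong[OF a(6)[of _ "Suc i'", simplified, OF this], of const_vec] show ?thesis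
      by (simp add: const_vec_mat_app dk v that)
  qed
  ultimately show "w \<in> tor_cycles F i j" by (simp add: tor_cycles_def)
qed

text \<open>A cycle pushed along \<phi> becomes a boundary in G, and \<psi> brings it back as a
  boundary in F. Since \<psi> \<phi> is homotopic to the identity, the original cycle differs from
  the result by another boundary.\<close>

lemma tor_vanishing_transfer:
  fixes F G :: "(('n::finite, 'k::field) mpoly, ('n, 'k) mpoly) free_complex"
  assumes F: "graded_free_resolution (*) (\<lambda>j. {p. homogeneous j p}) I F"
    and G: "graded_free_resolution (*) (\<lambda>j. {p. homogeneous j p}) I G"
    and van: "tor_cycles G i j \<subseteq> tor_boundaries G i j"
  shows "tor_cycles F i j \<subseteq> tor_boundaries F i j"
proof
  fix v assume v: "v \<in> tor_cycles F i j"
  have dkF: "diff_k F i' = mat_app (rk F i') (rk F (Suc i')) (const_mat (entry F i'))" for i'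
    by (simp add: diff_k_def const_mat_def)
  have dkG: "diff_k G i' = mat_app (rk G i') (rk G (Suc i')) (const_mat (entry G i'))" for i'
    by (simp add: diff_k_def const_mat_def)
  note RF = augmented_resolution_of_free_complex[OF F] and RG = augmented_resolution_of_free_complex[OF G]
  note a = augmented_resolutionD[OF RF] and a' = augmented_resolutionD[OF RG]
  let ?r = "case_nat 1 (rk F)" and ?r' = "case_nat 1 (rk G)"
  let ?d = "case_nat (\<lambda>_. 0) (bdeg F)" and ?d' = "case_nat (\<lambda>_. 0) (bdeg G)"
  let ?D = "case_nat (\<lambda>c b. aug F b) (entry F)" and ?D' = "case_nat (\<lambda>c b. aug G b) (entry G)"
  obtain \<phi> where \<phi>: "\<phi> 0 = mat_one" "\<And>i. graded_mat (?r' i) (?r i) (?d' i) (?d i) (\<phi> i)"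
    "\<And>i f. f \<in> vecs (?r (Suc i)) \<Longrightarrow>
       mat_app (?r' i) (?r' (Suc i)) (?D' i) (mat_app (?r' (Suc i)) (?r (Suc i)) (\<phi> (Suc i)) f)
         = mat_app (?r' i) (?r i) (\<phi> i) (mat_app (?r i) (?r (Suc i)) (?D i) f)"
    using chain_map_exists[OF RF RG] by blast
  obtain \<psi> where \<psi>: "\<psi> 0 = mat_one" "\<And>i. graded_mat (?r i) (?r' i) (?d i) (?d' i) (\<psi> i)"
    "\<And>i f. f \<in> vecs (?r' (Suc i)) \<Longrightarrow>
       mat_app (?r i) (?r (Suc i)) (?D i) (mat_app (?r (Suc i)) (?r' (Suc i)) (\<psi> (Suc i)) f)
         = mat_app (?r i) (?r' i) (\<psi> i) (mat_app (?r' i) (?r' (Suc i)) (?D' i) f)"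
    using chain_map_exists[OF RG RF] by blast
  define \<theta> where "\<theta> i = mat_mul (?r' i) (\<psi> i) (\<phi> i)" for i
  have \<theta>: "\<And>i f. mat_app (?r i) (?r i) (\<theta> i) f = mat_app (?r i) (?r' i) (\<psi> i) (mat_app (?r' i) (?r i) (\<phi> i) f)"
    by (simp add: \<theta>_def mat_app_mul)
  obtain h where h: "h 0 = (\<lambda>c b. 0)"
    "\<And>i. graded_mat (?r (Suc i)) (?r i) (?d (Suc i)) (?d i) (h i)"
    "\<And>i f. f \<in> vecs (?r (Suc i)) \<Longrightarrow>
       mat_app (?r (Suc i)) (?r (Suc (Suc i))) (?D (Suc i)) (mat_app (?r (Suc (Suc i))) (?r (Suc i)) (h (Suc i)) f)
       = mat_app (?r (Suc i)) (?r (Suc i)) (\<theta> (Suc i)) f - f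
         - mat_app (?r (Suc i)) (?r i) (h i) (mat_app (?r i) (?r (Suc i)) (?D i) f)"
  proof (rule null_homotopy_exists[OF RF, of \<theta>])
    show "mat_app (?r 0) (?r 0) (\<theta> 0) f = f" if "f \<in> vecs (?r 0)" for f
      using that unfolding \<theta> by (simp add: \<phi>(1) \<psi>(1) mat_app_one)
    show "graded_mat (?r i) (?r i) (?d i) (?d i) (\<theta> i)" for i
      unfolding \<theta>_def by (rule graded_mat_mul[OF \<psi>(2) \<phi>(2)])
    show "mat_app (?r i) (?r (Suc i)) (?D i) (mat_app (?r (Suc i)) (?r (Suc i)) (\<theta> (Suc i)) f)
           = mat_app (?r i) (?r i) (\<theta> i) (mat_app (?r i) (?r (Suc i)) (?D i) f)"
      if "f \<in> vecs (?r (Suc i))" for i f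
      unfolding \<theta> by (subst \<psi>(3)) (simp_all only: mat_app_in_vecs \<phi>(3)[OF that])
  qed blast
  have tF: "tensor_k F i' j' = {v. \<forall>b. v b \<noteq> 0 \<longrightarrow> b < ?r (Suc i') \<and> ?d (Suc i') b = j'}" for i' j'
    by (simp add: tensor_k_def)
  have tG: "tensor_k G i' j' = {v. \<forall>b. v b \<noteq> 0 \<longrightarrow> b < ?r' (Suc i') \<and> ?d' (Suc i') b = j'}" for i' j'
    by (simp add: tensor_k_def)
  \<comment> \<open>F_i sits in position \<open>Suc i\<close> of the augmented resolution, hence the
    shifted index.\<close>
  let ?\<phi> = "\<lambda>i. mat_app (rk G i) (rk F i) (const_mat (\<phi> (Suc i)))"
  let ?\<psi> = "\<lambda>i. mat_app (rk F i) (rk G i) (const_mat (\<psi> (Suc i)))"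
  let ?h = "mat_app (rk F (Suc i)) (rk F i) (const_mat (h (Suc i)))"
  let ?f = "of_const_vec v :: nat \<Rightarrow> ('n, 'k) mpoly"
  have vt: "v \<in> tensor_k F i j" and vc: "\<And>i'. i = Suc i' \<Longrightarrow> diff_k F i' v = 0"
    using v by (auto simp: tor_cycles_def)
  then have fv: "?f \<in> vecs (rk F i)"
    by (simp add: tensor_k_in_vecs)
  have "?\<phi> i v \<in> tensor_k G i j"
    using const_mat_graded[OF \<phi>(2)[of "Suc i"], of v j] vt unfolding tF tG by simp
  moreover have "diff_k G i' (?\<phi> i v) = 0" if "i = Suc i'" for i'
    using arg_cong[OF \<phi>(3)[of ?f i], of const_vec] fv vc[OF that] that
    by (simp add: const_vec_mat_app dkF dkG)
  ultimately have "?\<phi> i v \<in> tor_boundaries G i j"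
    using van by (auto simp: tor_cycles_def)
  then obtain w where w: "w \<in> tensor_k G (Suc i) j" "?\<phi> i v = diff_k G i w"
    by (auto simp: tor_boundaries_def)
  then have fw: "of_const_vec w \<in> vecs (rk G (Suc i))"
    by (simp add: tensor_k_in_vecs)
  have 1: "?\<psi> i (?\<phi> i v) = diff_k F i (?\<psi> (Suc i) w)"
    using arg_cong[OF \<psi>(3)[of "of_const_vec w" "Suc i"], of const_vec] fw
    by (simp add: w const_vec_mat_app dkF dkG)
  \<comment> \<open>The summand h D of the homotopy relation dies modulo the variables: for i = 0
    because the homotopy starts with 0, otherwise because v is a cycle.\<close>
  have 2: "const_vec (mat_app (?r (Suc i)) (?r i) (h i) (mat_app (?r i) (?r (Suc i)) (?D i) ?f)) = 0"
  proof (cases i)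
    case 0
    then show ?thesis by (auto simp: h(1) const_vec_def mat_app_def)
  next
    case (Suc i')
    then show ?thesis using vc[OF Suc] by (simp add: const_vec_mat_app dkF)
  qed
  have "diff_k F i (?h v) = ?\<psi> i (?\<phi> i v) - v"
    using arg_cong[OF h(3)[of ?f i, unfolded \<theta>], of const_vec] fv 2
    by (simp add: const_vec_diff) (simp add: const_vec_mat_app dkF)
  then have "v = diff_k F i (?\<psi> (Suc i) w) - diff_k F i (?h v)" using 1 by simp
  also have "\<dots> = diff_k F i (?\<psi> (Suc i) w - ?h v)"
    by (simp add: dkF mat_app_diff)
  finally have "v = diff_k F i (?\<psi> (Suc i) w - ?h v)" .
  moreover have "?\<psi> (Suc i) w - ?h v \<in> tensor_k F (Suc i) j"
  proof -
    have "?\<psi> (Suc i) w \<in> tensor_k F (Suc i) j"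
      using const_mat_graded[OF \<psi>(2)[of "Suc (Suc i)"], of w j] w(1) unfolding tF tG by simp
    moreover have "?h v \<in> tensor_k F (Suc i) j"
      using const_mat_graded[OF h(2)[of "Suc i"], of v j] vt unfolding tF by simp
    ultimately show ?thesis by (rule tensor_k_diff)
  qed
  ultimately show "v \<in> tor_boundaries F i j" unfolding tor_boundaries_def by blast
qed

text \<open>A basis of \<open>B\<close> together with a vector of \<open>C\<close> outside
  \<open>B\<close> extends to a basis of \<open>C\<close>. The finite set \<open>T\<close>
  guarantees that the cardinalities compared are those of finite bases, as the ambient space of
  functions on \<open>nat\<close> has infinite dimension.\<close>

lemma (in vector_space) dim_less_of_psubset:
  assumes "finite T" "C \<subseteq> span T" "subspace B" "B \<subset> C"
  shows "dim B < dim C"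
proof -
  obtain BB where BB: "BB \<subseteq> B" "independent BB" "B \<subseteq> span BB"
    by (rule maximal_independent_subset)
  obtain x where x: "x \<in> C" "x \<notin> B" using assms(4) by blast
  have "span BB = B" using BB assms(3) by (intro span_subspace)
  then have "independent (insert x BB)" using x BB by (intro independent_insertI) auto
  moreover have "insert x BB \<subseteq> C" using x BB assms(4) by auto
  ultimately obtain CC where CC: "insert x BB \<subseteq> CC" "CC \<subseteq> C" "independent CC" "C \<subseteq> span CC"
    by (meson maximal_independent_subset_extend)
  have "finite CC" using independent_span_bound[OF assms(1) CC(3)] CC(2) assms(2) by auto
  moreover have "BB \<subset> CC" using CC(1) x BB by auto
  ultimately have "card BB < card CC" by (rule psubset_card_mono)
  then show ?thesis using BB CC by (metis basis_card_eq_dim)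
qed

text \<open>\<open>tor_dim\<close> is a truncated difference, so its vanishing says only that the
  cycles have no larger dimension than the boundaries. As the boundaries lie in the
  finite-dimensional space of cycles, a proper inclusion would make the dimensions differ.\<close>

lemma tor_dim_eq_0_iff:
  fixes F :: "(('n::finite, 'k::field) mpoly, ('n, 'k) mpoly) free_complex"
  assumes F: "graded_free_resolution (*) (\<lambda>j. {p. homogeneous j p}) I F"
  shows "tor_dim F i j = 0 \<longleftrightarrow> tor_cycles F i j \<subseteq> tor_boundaries F i j"
proof -
  interpret vector_space "\<lambda>(a :: 'k) (v :: nat \<Rightarrow> 'k) b. a * v b"
    by unfold_locales (auto simp: fun_eq_iff algebra_simps)
  have sub: "subspace (tor_boundaries F i j)"
  proof (rule subspaceI)
    have "0 \<in> tensor_k F (Suc i) j" by (simp add: tensor_k_def)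
    then show "0 \<in> tor_boundaries F i j" unfolding tor_boundaries_def
      by (rule rev_image_eqI) (simp add: diff_k_def)
  next
    fix x y assume "x \<in> tor_boundaries F i j" "y \<in> tor_boundaries F i j"
    then obtain v w where vw: "v \<in> tensor_k F (Suc i) j" "x = diff_k F i v"
      "w \<in> tensor_k F (Suc i) j" "y = diff_k F i w" by (auto simp: tor_boundaries_def)
    have "v + w \<in> tensor_k F (Suc i) j" using vw by (intro tensor_k_add)
    then show "x + y \<in> tor_boundaries F i j" unfolding tor_boundaries_def
      by (rule rev_image_eqI) (simp add: vw diff_k_def mat_app_add)
  next
    fix c x assume "x \<in> tor_boundaries F i j"
    then obtain v where v: "v \<in> tensor_k F (Suc i) j" "x = diff_k F i v"
      by (auto simp: tor_boundaries_def)
    have "(\<lambda>b. c * v b) \<in> tensor_k F (Suc i) j" using v by (auto simp: tensor_k_def)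
    then show "(\<lambda>b. c * x b) \<in> tor_boundaries F i j" unfolding tor_boundaries_def
      by (rule rev_image_eqI) (simp add: v diff_k_def mat_app_scale)
  qed
  have "tor_cycles F i j \<subseteq> span (unit_vec ` {..<rk F i})"
  proof
    fix v assume "v \<in> tor_cycles F i j"
    then have v: "v b = 0" if "\<not> b < rk F i" for b
      using that by (auto simp: tor_cycles_def tensor_k_def)
    have sum_at: "sum g S c = (\<Sum>b\<in>S. g b c)" for g :: "nat \<Rightarrow> nat \<Rightarrow> 'k" and S c
      by (induction S rule: infinite_finite_induct) auto
    have "v = (\<Sum>b<rk F i. (\<lambda>c. v b * unit_vec b c))"
      by (auto simp: fun_eq_iff sum_at unit_vec_def v if_distrib[of "\<lambda>x. _ * x"] cong: if_cong)
    also have "\<dots> \<in> span (unit_vec ` {..<rk F i})"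
      by (intro span_sum span_scale span_base) auto
    finally show "v \<in> span (unit_vec ` {..<rk F i})" .
  qed
  from dim_less_of_psubset[OF _ this sub] tor_boundaries_subset_cycles[OF F, of i j]
  have "tor_boundaries F i j = tor_cycles F i j \<or> dim (tor_boundaries F i j) < dim (tor_cycles F i j)"
    by blast
  then show ?thesis using tor_boundaries_subset_cycles[OF F, of i j]
    unfolding tor_dim_def kdim_def by (elim disjE) auto
qed

text \<open>Transfer in both directions between \<open>F\<close> and the resolution chosen inside
  \<open>betti\<close>; \<open>F\<close> also witnesses that this choice really is a
  resolution.\<close>

lemma betti_eq_0_iff:
  fixes F :: "(('n::finite, 'k::field) mpoly, ('n, 'k) mpoly) free_complex"
  assumes F: "graded_free_resolution (*) (\<lambda>j. {p. homogeneous j p}) I F"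
  shows "betti (*) (\<lambda>j. {p. homogeneous j p}) I i j = 0 \<longleftrightarrow> tor_cycles F i j \<subseteq> tor_boundaries F i j"
proof -
  define G where "G = (SOME F. graded_free_resolution (*) (\<lambda>j. {p :: ('n, 'k) mpoly. homogeneous j p}) I F)"
  have G: "graded_free_resolution (*) (\<lambda>j. {p. homogeneous j p}) I G"
    unfolding G_def using F by (rule someI)
  have "betti (*) (\<lambda>j. {p. homogeneous j p}) I i j = tor_dim G i j"
    by (simp add: betti_def G_def)
  then show ?thesis
    using tor_vanishing_transfer[OF F G] tor_vanishing_transfer[OF G F] tor_dim_eq_0_iff[OF G] by metis
qed


section \<open>Monomial ideals\<close>

text \<open>Divisibility of monomials on exponent vectors; \<open>mon_dvd_mon_iff\<close> ties it to
  \<open>dvd\<close>.\<close>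

definition mle :: "'n monomial \<Rightarrow> 'n monomial \<Rightarrow> bool" where
  "mle s t \<longleftrightarrow> (\<forall>x. Poly_Mapping.lookup s x \<le> Poly_Mapping.lookup t x)"

lemma mle_refl [simp]: "mle s s"
  by (simp add: mle_def)

lemma mle_trans: "mle r s \<Longrightarrow> mle s t \<Longrightarrow> mle r t"
  unfolding mle_def using order_trans by blast

lemma mle_antisym: "mle s t \<Longrightarrow> mle t s \<Longrightarrow> s = t"
  by (auto simp: mle_def poly_mapping_eq_iff fun_eq_iff intro: antisym)

lemma zero_mle [simp]: "mle 0 s"
  by (simp add: mle_def)

lemma mle_add_left [simp]: "mle s (t + s)"
  by (simp add: mle_def lookup_add)

lemma diff_mle: "mle (s - t) s"
  by (simp add: mle_def lookup_minus)

lemma mle_add_diff: "mle s t \<Longrightarrow> s + (t - s) = t"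
  by (rule poly_mapping_eqI) (simp add: mle_def lookup_add lookup_minus)

lemma mle_diff_eq_0_iff: "t - s = 0 \<longleftrightarrow> mle t s"
  by (auto simp: mle_def poly_mapping_eq_iff fun_eq_iff lookup_minus)

lemma mdeg_mono: "mle s t \<Longrightarrow> mdeg s \<le> mdeg t"
  by (auto simp: mle_def mdeg_def intro: sum_mono)

lemma mdeg_diff: "mle s t \<Longrightarrow> mdeg (t - s) = mdeg t - mdeg s"
  using mdeg_add[of s "t - s"] by (simp add: mle_add_diff)

text \<open>Subtraction of exponent vectors is truncated; under \<open>mle s t\<close> it is the
  exact quotient, and otherwise no term of the product has exponent \<open>t\<close>.\<close>

lemma lookup_single_mult:
  fixes p :: "('n, 'k::field) mpoly"
  shows "Poly_Mapping.lookup (Poly_Mapping.single s a * p) t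
      = (if mle s t then a * Poly_Mapping.lookup p (t - s) else 0)"
proof -
  have *: "t = s + r \<longleftrightarrow> mle s t \<and> r = t - s" for r
    by (auto simp: mle_add_diff) (simp add: mle_def lookup_add)
  have "Poly_Mapping.lookup (Poly_Mapping.single s a * p) t
      = Sum_any (\<lambda>l. (a * Sum_any (\<lambda>r. Poly_Mapping.lookup p r when t = l + r)) when s = l)"
    by (simp add: lookup_mult lookup_single when_mult)
  also have "\<dots> = a * Sum_any (\<lambda>r. Poly_Mapping.lookup p r when t = s + r)"
    by simp
  also have "\<dots> = (if mle s t then a * Poly_Mapping.lookup p (t - s) else 0)"
    unfolding * by auto
  finally show ?thesis .
qed

lemma mon_mult: "mon s * mon t = (mon (s + t) :: ('n, 'k::field) mpoly)"
  by (simp add: mon_def mult_single)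

lemma mon_dvd_mon_iff: "(mon s :: ('n, 'k::field) mpoly) dvd mon t \<longleftrightarrow> mle s t"
proof
  assume "mle s t"
  then have "mon t = mon s * (mon (t - s) :: ('n, 'k) mpoly)"
    by (simp add: mon_mult mle_add_diff)
  then show "(mon s :: ('n, 'k) mpoly) dvd mon t" by (rule dvdI)
next
  assume "(mon s :: ('n, 'k) mpoly) dvd mon t"
  then obtain r :: "('n, 'k) mpoly" where "mon t = mon s * r" by (rule dvdE)
  from arg_cong[OF this, of "\<lambda>p. Poly_Mapping.lookup p t"] show "mle s t"
    by (simp add: mon_def lookup_single_mult split: if_splits)
qed

lemma poly_sum_of_monomials:
  "p = (\<Sum>t\<in>Poly_Mapping.keys p. Poly_Mapping.single t (Poly_Mapping.lookup p t))"
  by (rule poly_mapping_eqI) (simp add: lookup_sum lookup_single when_def in_keys_iff sum.delta')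

text \<open>The polynomials on the right form an ideal containing the generators; conversely such a
  polynomial is the sum of its terms, each a multiple of a generator.\<close>

lemma in_ideal_of_mon_iff:
  fixes p :: "('n, 'k::field) mpoly"
  shows "p \<in> ideal_of (mon ` S) \<longleftrightarrow> (\<forall>t\<in>Poly_Mapping.keys p. \<exists>s\<in>S. mle s t)"
proof -
  interpret module "(*) :: ('n, 'k) mpoly \<Rightarrow> _"
    by unfold_locales (simp_all add: algebra_simps)
  let ?M = "{p :: ('n, 'k) mpoly. \<forall>t\<in>Poly_Mapping.keys p. \<exists>s\<in>S. mle s t}"
  have "subspace ?M"
  proof (rule subspaceI)
    fix p q assume "p \<in> ?M" "q \<in> ?M"
    then show "p + q \<in> ?M" using keys_add[of p q] by auto
  next
    fix c p assume p: "p \<in> ?M"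
    show "c * p \<in> ?M"
    proof (clarify)
      fix t assume "t \<in> Poly_Mapping.keys (c * p)"
      then obtain r s where "t = r + s" "s \<in> Poly_Mapping.keys p" using keys_mult[of c p] by blast
      with p mle_trans[OF _ mle_add_left[of s r]] show "\<exists>s\<in>S. mle s t" by blast
    qed
  qed simp
  then have "ideal_of (mon ` S) \<subseteq> ?M"
    unfolding ideal_of_def by (intro span_minimal) (force simp: mon_def)
  moreover have "p \<in> ideal_of (mon ` S)" if p: "p \<in> ?M" for p
  proof -
    have "Poly_Mapping.single t (Poly_Mapping.lookup p t) \<in> span (mon ` S)"
      if t: "t \<in> Poly_Mapping.keys p" for t
    proof -
      obtain s where s: "s \<in> S" "mle s t" using p t by blast
      have "Poly_Mapping.single (t - s) (Poly_Mapping.lookup p t) * mon s \<in> span (mon ` S)"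
        using s by (intro span_scale span_base) simp
      then show ?thesis using mle_add_diff[OF s(2)] by (simp add: mon_def mult_single add.commute)
    qed
    then have "(\<Sum>t\<in>Poly_Mapping.keys p. Poly_Mapping.single t (Poly_Mapping.lookup p t)) \<in> span (mon ` S)"
      by (rule span_sum)
    then show ?thesis unfolding ideal_of_def by (simp only: poly_sum_of_monomials[symmetric])
  qed
  ultimately show ?thesis by blast
qed

lemma mon_in_ideal_of_mon_iff:
  "(mon t :: ('n, 'k::field) mpoly) \<in> ideal_of (mon ` S) \<longleftrightarrow> (\<exists>s\<in>S. mle s t)"
  unfolding in_ideal_of_mon_iff by (simp add: mon_def)

section \<open>Least common multiples\<close>

lemma mlcm_empty [simp]: "mlcm {} = 0"
  by (rule poly_mapping_eqI) (simp add: mlcm.rep_eq)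

lemma lookup_mlcm_insert:
  "finite S \<Longrightarrow> Poly_Mapping.lookup (mlcm (insert s S)) x
     = max (Poly_Mapping.lookup s x) (Poly_Mapping.lookup (mlcm S) x)"
  by (simp add: mlcm.rep_eq insert_commute[of 0] image_image)

lemma mlcm_mle_iff: "finite S \<Longrightarrow> mle (mlcm S) t \<longleftrightarrow> (\<forall>s\<in>S. mle s t)"
  by (induction S rule: finite_induct) (auto simp: mle_def lookup_mlcm_insert)

lemma mle_mlcm: "finite S \<Longrightarrow> s \<in> S \<Longrightarrow> mle s (mlcm S)"
  using mlcm_mle_iff mle_refl by blast

lemma mlcm_mono: "finite T \<Longrightarrow> S \<subseteq> T \<Longrightarrow> mle (mlcm S) (mlcm T)"
  by (meson mlcm_mle_iff mle_mlcm finite_subset subsetD)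

lemma mlcm_insert_eq_iff:
  assumes "finite S"
  shows "mlcm (insert s S) = mlcm S \<longleftrightarrow> mle s (mlcm S)"
proof
  assume "mlcm (insert s S) = mlcm S"
  then show "mle s (mlcm S)" using assms mle_mlcm[of "insert s S" s] by simp
next
  assume "mle s (mlcm S)"
  then have "mle (mlcm (insert s S)) (mlcm S)" using assms by (simp add: mlcm_mle_iff mle_mlcm)
  then show "mlcm (insert s S) = mlcm S"
    using mle_antisym mlcm_mono[of "insert s S" S] assms by blast
qed


section \<open>The Taylor resolution\<close>

text \<open>
  The multigraded strand of the Taylor complex in multidegree \<open>\<alpha>\<close> is the augmented chain complex of the
  full simplex on the generators dividing \<open>x\<^sup>\<alpha>\<close>; prepending the least such generator contracts it.
\<close>

definition face_sign :: "nat \<Rightarrow> nat set \<Rightarrow> 'a::comm_ring_1" where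
  "face_sign j \<sigma> = (- 1) ^ card {i \<in> \<sigma>. i < j}"

lemma face_sign_insert:
  "finite \<sigma> \<Longrightarrow> i \<notin> \<sigma> \<Longrightarrow> face_sign j (insert i \<sigma>) = (if i < j then - face_sign j \<sigma> else face_sign j \<sigma>)"
proof -
  assume "finite \<sigma>" "i \<notin> \<sigma>"
  moreover have "{k \<in> insert i \<sigma>. k < j} = (if i < j then insert i {k \<in> \<sigma>. k < j} else {k \<in> \<sigma>. k < j})"
    by auto
  ultimately show ?thesis by (simp add: face_sign_def)
qed

text \<open>Of \<open>i\<close> and \<open>j\<close> only the smaller one is counted in the sign of
  the other, so exactly one of the two inserted vertices flips a sign.\<close>

lemma face_sign_swap:
  assumes "finite \<sigma>" "i \<notin> \<sigma>" "j \<notin> \<sigma>" "i \<noteq> j"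
  shows "face_sign j \<sigma> * face_sign i (insert j \<sigma>) = - (face_sign i \<sigma> * face_sign j (insert i \<sigma>) :: 'a::comm_ring_1)"
  using assms by (cases "i < j") (simp_all add: face_sign_insert mult.commute)

lemma face_sign_eq_1: "(\<And>i. i \<in> \<sigma> \<Longrightarrow> j \<le> i) \<Longrightarrow> face_sign j \<sigma> = 1"
proof -
  assume "\<And>i. i \<in> \<sigma> \<Longrightarrow> j \<le> i"
  then have "{i \<in> \<sigma>. i < j} = {}" by (auto simp: not_less)
  then show ?thesis unfolding face_sign_def by (simp only: card.empty power_0)
qed

lemma face_sign_sq [simp]: "face_sign j \<sigma> * (face_sign j \<sigma> * a) = (a :: 'a::comm_ring_1)"
  by (simp add: face_sign_def)

text \<open>The summands at (i, j) and (j, i) cancel. The induction removes one row together with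
  its column; concluding from S = - S would fail in characteristic 2.\<close>

lemma sum_antisym_off_diagonal:
  fixes G :: "'b \<Rightarrow> 'b \<Rightarrow> 'a::ab_group_add"
  assumes "finite W" "\<And>i j. i \<in> W \<Longrightarrow> j \<in> W \<Longrightarrow> i \<noteq> j \<Longrightarrow> G i j = - G j i"
  shows "(\<Sum>j\<in>W. \<Sum>i\<in>W - {j}. G j i) = 0"
  using assms
proof (induction W rule: finite_induct)
  case (insert x W)
  have off: "(\<Sum>i\<in>insert x W - {j}. G j i) = G j x + (\<Sum>i\<in>W - {j}. G j i)" if "j \<in> W" for j
  proof -
    have *: "insert x W - {j} = insert x (W - {j})" "x \<notin> W - {j}" using insert.hyps that by auto
    show ?thesis unfolding *(1) using insert.hyps *(2) by simp
  qed
  have IH: "(\<Sum>j\<in>W. \<Sum>i\<in>W - {j}. G j i) = 0"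
    by (rule insert.IH) (rule insert.prems, auto)
  have row: "(\<Sum>i\<in>W. G x i) = (\<Sum>i\<in>W. - G i x)"
  proof (rule sum.cong)
    fix i assume "i \<in> W"
    then show "G x i = - G i x" using insert.hyps by (intro insert.prems) auto
  qed simp
  have "(\<Sum>j\<in>insert x W. \<Sum>i\<in>insert x W - {j}. G j i)
      = (\<Sum>i\<in>insert x W - {x}. G x i) + (\<Sum>j\<in>W. \<Sum>i\<in>insert x W - {j}. G j i)"
    using insert.hyps by (rule sum.insert)
  also have "insert x W - {x} = W" using insert.hyps by auto
  also have "(\<Sum>j\<in>W. \<Sum>i\<in>insert x W - {j}. G j i) = (\<Sum>j\<in>W. G j x + (\<Sum>i\<in>W - {j}. G j i))"
    by (intro sum.cong refl off)
  also have "\<dots> = (\<Sum>j\<in>W. G j x)"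
    unfolding sum.distrib IH by simp
  finally show ?case unfolding row by (simp add: sum_negf)
qed simp

text \<open>The coefficient at \<sigma> of the simplicial boundary of the chain \<open>c\<close>,
  hence a sum over the cofaces of \<sigma>. The value at the empty face is the augmentation.\<close>

definition simplex_boundary :: "nat set \<Rightarrow> (nat set \<Rightarrow> 'a::comm_ring_1) \<Rightarrow> nat set \<Rightarrow> 'a" where
  "simplex_boundary V c \<sigma> = (\<Sum>j\<in>V - \<sigma>. face_sign j \<sigma> * c (insert j \<sigma>))"

lemma simplex_boundary_boundary:
  assumes "finite V" "\<sigma> \<subseteq> V"
  shows "simplex_boundary V (simplex_boundary V c) \<sigma> = 0"
proof -
  have fin: "finite \<sigma>" using assms finite_subset by auto
  let ?G = "\<lambda>j i. face_sign j \<sigma> * (face_sign i (insert j \<sigma>) * c (insert i (insert j \<sigma>)))"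
  have "simplex_boundary V (simplex_boundary V c) \<sigma> = (\<Sum>j\<in>V - \<sigma>. \<Sum>i\<in>(V - \<sigma>) - {j}. ?G j i)"
    unfolding simplex_boundary_def sum_distrib_left
    by (intro sum.cong refl) auto
  also have "\<dots> = 0"
  proof (rule sum_antisym_off_diagonal)
    fix i j assume "i \<in> V - \<sigma>" "j \<in> V - \<sigma>" "i \<noteq> j"
    then have "face_sign i \<sigma> * face_sign j (insert i \<sigma>) = - (face_sign j \<sigma> * face_sign i (insert j \<sigma>) :: 'a)"
      using fin by (intro face_sign_swap) auto
    then show "?G i j = - ?G j i"
      by (simp add: insert_commute mult.assoc[symmetric])
  qed (use assms in simp)
  finally show ?thesis .
qed

text \<open>The cone with apex \<open>j0\<close>. No vertex in the support of \<open>c\<close>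
  precedes \<open>j0\<close>, so prepending it costs no sign. Off the apex only one coface
  contributes, and it gives c \<sigma>; at a face containing the apex, the cycle condition one
  dimension lower expresses c \<sigma> by the other cofaces.\<close>

lemma simplex_contraction:
  assumes V: "finite V" "\<sigma> \<subseteq> V" "j0 \<in> V"
    and supp: "\<And>\<tau> j. \<tau> \<subseteq> V \<Longrightarrow> c \<tau> \<noteq> 0 \<Longrightarrow> j \<in> \<tau> \<Longrightarrow> j0 \<le> j"
    and cyc: "j0 \<in> \<sigma> \<Longrightarrow> simplex_boundary V c (\<sigma> - {j0}) = 0"
  shows "simplex_boundary V (\<lambda>\<tau>. if j0 \<in> \<tau> then c (\<tau> - {j0}) else 0) \<sigma> = c \<sigma>"
proof (cases "j0 \<in> \<sigma>")
  case False
  have "simplex_boundary V (\<lambda>\<tau>. if j0 \<in> \<tau> then c (\<tau> - {j0}) else 0) \<sigma>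
      = (\<Sum>j\<in>V - \<sigma>. if j = j0 then face_sign j0 \<sigma> * c \<sigma> else 0)"
    unfolding simplex_boundary_def using False by (intro sum.cong) auto
  also have "\<dots> = face_sign j0 \<sigma> * c \<sigma>" using V False by simp
  also have "\<dots> = c \<sigma>"
  proof (cases "c \<sigma> = 0")
    case False
    then have "face_sign j0 \<sigma> = (1 :: 'a)" by (intro face_sign_eq_1 supp[of \<sigma>]) (use V in auto)
    then show ?thesis by simp
  qed simp
  finally show ?thesis .
next
  case True
  define \<rho> where "\<rho> = \<sigma> - {j0}"
  have \<rho>: "\<sigma> = insert j0 \<rho>" "j0 \<notin> \<rho>" "finite \<rho>" using True V finite_subset by (auto simp: \<rho>_def)
  have split: "V - \<rho> = insert j0 (V - \<sigma>)" "j0 \<notin> V - \<sigma>"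
    using True V by (auto simp: \<rho>_def)
  \<comment> \<open>Among the cofaces of \<rho>, the one obtained by adding \<open>j0\<close> is
    \<sigma> itself; isolating it solves the cycle condition for c \<sigma>.\<close>
  have "0 = simplex_boundary V c \<rho>" using cyc[OF True] by (simp only: \<rho>_def)
  also have "\<dots> = face_sign j0 \<rho> * c (insert j0 \<rho>) + (\<Sum>j\<in>V - \<sigma>. face_sign j \<rho> * c (insert j \<rho>))"
    unfolding simplex_boundary_def split(1) by (rule sum.insert) (use V split(2) in auto)
  also have "insert j0 \<rho> = \<sigma>" by (simp only: \<rho>(1))
  also have "face_sign j0 \<rho> * c \<sigma> = c \<sigma>"
  proof (cases "c \<sigma> = 0")
    case False
    then have "face_sign j0 \<rho> = (1 :: 'a)"
      by (intro face_sign_eq_1 supp[OF V(2)]) (auto simp: \<rho>_def)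
    then show ?thesis by simp
  qed simp
  finally have "c \<sigma> = (\<Sum>j\<in>V - \<sigma>. - (face_sign j \<rho> * c (insert j \<rho>)))"
    by (simp only: sum_negf eq_neg_iff_add_eq_0)
  also have "\<dots> = (\<Sum>j\<in>V - \<sigma>. face_sign j \<sigma> * c (insert j \<rho>))"
  proof (rule sum.cong)
    fix j assume j: "j \<in> V - \<sigma>"
    show "- (face_sign j \<rho> * c (insert j \<rho>)) = face_sign j \<sigma> * c (insert j \<rho>)"
    proof (cases "c (insert j \<rho>) = 0")
      case False
      moreover have "insert j \<rho> \<subseteq> V" using j V(2) by (auto simp: \<rho>_def)
      ultimately have "j0 \<le> j" by (intro supp[of "insert j \<rho>" j]) auto
      moreover have "j \<noteq> j0" using j True by auto
      ultimately have "j0 < j" by simp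
      then have "face_sign j \<sigma> = (- face_sign j \<rho> :: 'a)"
        unfolding \<rho>(1) by (simp add: \<rho>(2,3) face_sign_insert)
      then show ?thesis by simp
    qed simp
  qed simp
  also have "\<dots> = simplex_boundary V (\<lambda>\<tau>. if j0 \<in> \<tau> then c (\<tau> - {j0}) else 0) \<sigma>"
    unfolding simplex_boundary_def
  proof (rule sum.cong)
    fix j assume "j \<in> V - \<sigma>"
    then have "insert j \<sigma> - {j0} = insert j \<rho>" "j0 \<in> insert j \<sigma>" using True by (auto simp: \<rho>_def)
    then show "face_sign j \<sigma> * c (insert j \<rho>)
        = face_sign j \<sigma> * (if j0 \<in> insert j \<sigma> then c (insert j \<sigma> - {j0}) else 0)" by simp
  qed simp
  finally show ?thesis by simp
qed

section \<open>The Taylor differential and its multigraded strands\<close>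

abbreviation (input) flcm :: "(nat \<Rightarrow> 'n::finite monomial) \<Rightarrow> nat set \<Rightarrow> 'n monomial" where
  "flcm u \<tau> \<equiv> mlcm (u ` \<tau>)"

text \<open>Chains are families of polynomials indexed by subsets. The empty subset stands for R, so
  that the augmentation is the value at the empty subset.\<close>

definition taylor_boundary ::
  "nat set \<Rightarrow> (nat \<Rightarrow> 'n::finite monomial) \<Rightarrow> (nat set \<Rightarrow> ('n, 'k::field) mpoly) \<Rightarrow> nat set \<Rightarrow> ('n, 'k) mpoly" where
  "taylor_boundary V u f \<sigma> = (\<Sum>j\<in>V - \<sigma>.
     Poly_Mapping.single (flcm u (insert j \<sigma>) - flcm u \<sigma>) (face_sign j \<sigma>) * f (insert j \<sigma>))"

text \<open>The part of \<open>f\<close> in multidegree \<alpha>: the basis element \<sigma> has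
  multidegree lcm(\<sigma>), so its coefficient is taken at \<alpha> - lcm(\<sigma>).\<close>

definition strand ::
  "(nat \<Rightarrow> 'n::finite monomial) \<Rightarrow> (nat set \<Rightarrow> ('n, 'k::field) mpoly) \<Rightarrow> 'n monomial \<Rightarrow> nat set \<Rightarrow> 'k" where
  "strand u f \<alpha> \<sigma> = (if mle (flcm u \<sigma>) \<alpha> then Poly_Mapping.lookup (f \<sigma>) (\<alpha> - flcm u \<sigma>) else 0)"

lemma strand_eqI:
  assumes "\<And>\<alpha>. strand u f \<alpha> \<sigma> = strand u g \<alpha> \<sigma>"
  shows "f \<sigma> = g \<sigma>"
proof (rule poly_mapping_eqI)
  fix t
  show "Poly_Mapping.lookup (f \<sigma>) t = Poly_Mapping.lookup (g \<sigma>) t"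
    using assms[of "t + flcm u \<sigma>"] by (simp add: strand_def)
qed

lemma mle_diff_cancel:
  "mle l l' \<Longrightarrow> mle l \<alpha> \<Longrightarrow> mle (l' - l) (\<alpha> - l) \<longleftrightarrow> mle l' \<alpha>"
  unfolding mle_def lookup_minus by (simp add: le_diff_iff)

text \<open>The monomial coefficients of the Taylor differential exactly compensate the different
  multidegrees of the basis elements, so only signs remain within a strand.\<close>

lemma strand_taylor_boundary:
  assumes "finite V" "\<sigma> \<subseteq> V"
  shows "strand u (taylor_boundary V u f) \<alpha> \<sigma> = simplex_boundary V (strand u f \<alpha>) \<sigma>"
proof (cases "mle (flcm u \<sigma>) \<alpha>")
  case True
  have "Poly_Mapping.lookup (Poly_Mapping.single (flcm u (insert j \<sigma>) - flcm u \<sigma>) (face_sign j \<sigma>) * f (insert j \<sigma>))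
           (\<alpha> - flcm u \<sigma>) = face_sign j \<sigma> * strand u f \<alpha> (insert j \<sigma>)" for j
  proof -
    have le: "mle (flcm u \<sigma>) (flcm u (insert j \<sigma>))"
      using assms finite_subset by (intro mlcm_mono) auto
    have "\<alpha> - flcm u \<sigma> - (flcm u (insert j \<sigma>) - flcm u \<sigma>) = \<alpha> - flcm u (insert j \<sigma>)"
      by (rule poly_mapping_eqI) (use le in \<open>simp add: mle_def lookup_minus\<close>)
    then show ?thesis
      by (simp add: lookup_single_mult mle_diff_cancel[OF le True] strand_def del: image_insert)
  qed
  then show ?thesis using True
    by (simp add: strand_def[of u "taylor_boundary V u f"] taylor_boundary_def lookup_sum simplex_boundary_def)
next
  case False
  have "strand u f \<alpha> (insert j \<sigma>) = 0" for j
  proof -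
    have "mle (flcm u \<sigma>) (flcm u (insert j \<sigma>))"
      using assms finite_subset by (intro mlcm_mono) auto
    then show ?thesis using False mle_trans by (auto simp: strand_def)
  qed
  then show ?thesis using False by (simp add: strand_def[of u "taylor_boundary V u f"] simplex_boundary_def)
qed

lemma taylor_boundary_boundary:
  assumes "finite V" "\<sigma> \<subseteq> V"
  shows "taylor_boundary V u (taylor_boundary V u f) \<sigma> = 0"
proof -
  have "strand u (taylor_boundary V u (taylor_boundary V u f)) \<alpha> \<sigma> = strand u (\<lambda>_. 0) \<alpha> \<sigma>" for \<alpha>
  proof -
    have "strand u (taylor_boundary V u (taylor_boundary V u f)) \<alpha> \<sigma>
        = (\<Sum>j\<in>V - \<sigma>. face_sign j \<sigma> * simplex_boundary V (strand u f \<alpha>) (insert j \<sigma>))"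
      unfolding strand_taylor_boundary[OF assms] simplex_boundary_def[of _ _ \<sigma>]
      using assms by (intro sum.cong refl) (simp add: strand_taylor_boundary)
    also have "\<dots> = 0"
      using simplex_boundary_boundary[OF assms, of "strand u f \<alpha>"] by (simp only: simplex_boundary_def[of _ _ \<sigma>])
    finally show ?thesis by (simp add: strand_def)
  qed
  from strand_eqI[OF this] show ?thesis .
qed

definition divisors :: "nat set \<Rightarrow> (nat \<Rightarrow> 'n monomial) \<Rightarrow> 'n monomial \<Rightarrow> nat set" where
  "divisors V u \<alpha> = {j \<in> V. mle (u j) \<alpha>}"

definition strand_contraction ::
  "nat set \<Rightarrow> (nat \<Rightarrow> 'n::finite monomial) \<Rightarrow> (nat set \<Rightarrow> ('n, 'k::field) mpoly) \<Rightarrow> 'n monomial \<Rightarrow> nat set \<Rightarrow> 'k" where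
  "strand_contraction V u f \<alpha> \<tau> =
     (if divisors V u \<alpha> \<noteq> {} \<and> Min (divisors V u \<alpha>) \<in> \<tau>
      then strand u f \<alpha> (\<tau> - {Min (divisors V u \<alpha>)}) else 0)"

text \<open>The strandwise contractions glued together: the exponent t at the face \<tau> belongs to
  multidegree t + lcm(\<tau>).\<close>

definition taylor_contraction ::
  "nat set \<Rightarrow> (nat \<Rightarrow> 'n::finite monomial) \<Rightarrow> (nat set \<Rightarrow> ('n, 'k::field) mpoly) \<Rightarrow> nat set \<Rightarrow> ('n, 'k) mpoly" where
  "taylor_contraction V u f \<tau> = Poly_Mapping.Abs_poly_mapping (\<lambda>t. strand_contraction V u f (t + flcm u \<tau>) \<tau>)"

text \<open>The point is finite support. The vertex removed from \<tau> varies with t, but it is one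
  of the finitely many elements of \<tau>, and each f (\<tau> - {j}) has finitely many
  terms.\<close>

lemma lookup_taylor_contraction:
  assumes "finite \<tau>"
  shows "Poly_Mapping.lookup (taylor_contraction V u f \<tau>) t = strand_contraction V u f (t + flcm u \<tau>) \<tau>"
proof -
  let ?N = "\<lambda>j. {t. strand u f (t + flcm u \<tau>) (\<tau> - {j}) \<noteq> 0}"
  have "finite (?N j)" for j
  proof -
    have le: "mle (flcm u (\<tau> - {j})) (flcm u \<tau>)" using assms by (intro mlcm_mono) auto
    have shift: "t + flcm u \<tau> - flcm u (\<tau> - {j}) = t + (flcm u \<tau> - flcm u (\<tau> - {j}))" for t
      by (rule poly_mapping_eqI) (use le in \<open>simp add: mle_def lookup_minus lookup_add\<close>)
    have "finite ((\<lambda>t. t + (flcm u \<tau> - flcm u (\<tau> - {j}))) -` Poly_Mapping.keys (f (\<tau> - {j})))"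
      by (rule finite_vimageI) (auto simp: inj_def)
    then show ?thesis
      by (rule rev_finite_subset) (auto simp: strand_def shift in_keys_iff split: if_splits)
  qed
  then have "finite (\<Union>j\<in>\<tau>. ?N j)" using assms by auto
  then have "finite {t. strand_contraction V u f (t + flcm u \<tau>) \<tau> \<noteq> 0}"
    by (rule rev_finite_subset) (auto simp: strand_contraction_def split: if_splits)
  then show ?thesis unfolding taylor_contraction_def by (simp add: lookup_Abs_poly_mapping)
qed

text \<open>A nonzero contracted value at \<tau> means that the removed vertex and all the others
  divide x^\<alpha>, so lcm(\<tau>) does too; thus nothing is lost by reading only exponents t +
  lcm(\<tau>).\<close>

lemma strand_taylor_contraction:
  assumes "finite V" "\<tau> \<subseteq> V"
  shows "strand u (taylor_contraction V u f) \<alpha> \<tau> = strand_contraction V u f \<alpha> \<tau>"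
proof -
  have fin: "finite \<tau>" using assms finite_subset by auto
  show ?thesis
  proof (cases "mle (flcm u \<tau>) \<alpha>")
    case True
    then show ?thesis
      using mle_add_diff[OF True] by (simp add: strand_def lookup_taylor_contraction[OF fin] add.commute)
  next
    case False
    have "strand_contraction V u f \<alpha> \<tau> = 0"
    proof (rule ccontr)
      let ?j = "Min (divisors V u \<alpha>)"
      assume nz: "strand_contraction V u f \<alpha> \<tau> \<noteq> 0"
      then have "divisors V u \<alpha> \<noteq> {}" "mle (flcm u (\<tau> - {?j})) \<alpha>"
        by (auto simp: strand_contraction_def strand_def split: if_splits)
      moreover from this have "?j \<in> divisors V u \<alpha>"
        using assms by (intro Min_in) (auto simp: divisors_def)
      then have "mle (u ?j) \<alpha>" by (simp add: divisors_def)
      ultimately have "mle (u i) \<alpha>" if "i \<in> \<tau>" for i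
        using fin that by (cases "i = ?j") (auto simp: mlcm_mle_iff)
      then show False using False fin by (simp add: mlcm_mle_iff)
    qed
    then show ?thesis using False by (simp add: strand_def)
  qed
qed

text \<open>Exactness in all positions at once. Each strand is contracted as a simplex, except those
  in multidegrees that no generator divides; at the empty face these are controlled by membership in
  the ideal.\<close>

lemma taylor_boundary_contraction:
  assumes V: "finite V" "\<sigma> \<subseteq> V"
    and cyc: "\<And>j. j \<in> \<sigma> \<Longrightarrow> taylor_boundary V u f (\<sigma> - {j}) = 0"
    and nonempty: "\<sigma> = {} \<Longrightarrow> f {} \<in> ideal_of (mon ` u ` V)"
  shows "taylor_boundary V u (taylor_contraction V u f) \<sigma> = f \<sigma>"
proof (rule strand_eqI[of u])
  fix \<alpha>
  let ?J = "divisors V u \<alpha>"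
  have fin: "finite \<sigma>" using V finite_subset by auto
  have "simplex_boundary V (strand u (taylor_contraction V u f) \<alpha>) \<sigma>
      = simplex_boundary V (strand_contraction V u f \<alpha>) \<sigma>"
    unfolding simplex_boundary_def
    by (intro sum.cong refl arg_cong2[of _ _ _ _ "(*)"] strand_taylor_contraction) (use V in auto)
  also have "\<dots> = strand u f \<alpha> \<sigma>"
  \<comment> \<open>Without a generator dividing x^\<alpha> there is no apex. Nonempty faces are
    then absent from the strand, and at the empty face f {} has no term x^\<alpha>.\<close>
  proof (cases "?J = {}")
    case True
    have "strand u f \<alpha> \<sigma> = 0"
    proof (cases "\<sigma> = {}")
      case e: True
      have "\<alpha> \<notin> Poly_Mapping.keys (f {})"
        using True nonempty[OF e] by (auto simp: in_ideal_of_mon_iff divisors_def)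
      then show ?thesis by (simp add: strand_def e in_keys_iff)
    next
      case False
      then obtain j where "j \<in> \<sigma>" by blast
      then have "\<not> mle (flcm u \<sigma>) \<alpha>" using True V fin by (auto simp: mlcm_mle_iff divisors_def)
      then show ?thesis by (simp add: strand_def)
    qed
    then show ?thesis using True by (simp add: simplex_boundary_def strand_contraction_def)
  next
    case False
    have "finite ?J" using V by (simp add: divisors_def)
    note Min = Min_in[OF this False] Min_le[OF this]
    have "simplex_boundary V (\<lambda>\<tau>. if Min ?J \<in> \<tau> then strand u f \<alpha> (\<tau> - {Min ?J}) else 0) \<sigma> = strand u f \<alpha> \<sigma>"
    proof (rule simplex_contraction[OF V])
      show "Min ?J \<in> V" using Min(1) by (simp add: divisors_def)
    next
      fix \<tau> j assume "\<tau> \<subseteq> V" "strand u f \<alpha> \<tau> \<noteq> 0" "j \<in> \<tau>"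
      moreover from this have "finite \<tau>" using V finite_subset by auto
      ultimately have "j \<in> ?J" by (auto simp: strand_def mlcm_mle_iff divisors_def split: if_splits)
      then show "Min ?J \<le> j" by (rule Min(2))
    next
      assume "Min ?J \<in> \<sigma>"
      moreover have "\<sigma> - {Min ?J} \<subseteq> V" using V by auto
      moreover from calculation have "strand u (taylor_boundary V u f) \<alpha> (\<sigma> - {Min ?J}) = 0"
        using cyc[of "Min ?J"] by (simp add: strand_def)
      ultimately show "simplex_boundary V (strand u f \<alpha>) (\<sigma> - {Min ?J}) = 0"
        using strand_taylor_boundary[OF V(1), of "\<sigma> - {Min ?J}" u f \<alpha>] by simp
    qed
    moreover have "strand_contraction V u f \<alpha> = (\<lambda>\<tau>. if Min ?J \<in> \<tau> then strand u f \<alpha> (\<tau> - {Min ?J}) else 0)"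
      using False by (simp add: strand_contraction_def fun_eq_iff)
    ultimately show ?thesis by simp
  qed
  finally show "strand u (taylor_boundary V u (taylor_contraction V u f)) \<alpha> \<sigma> = strand u f \<alpha> \<sigma>"
    by (simp only: strand_taylor_boundary[OF V])
qed

section \<open>Enumerating faces: from families indexed by subsets to matrices\<close>

definition faces :: "nat set \<Rightarrow> nat \<Rightarrow> nat set set" where
  "faces V i = {\<tau>. \<tau> \<subseteq> V \<and> card \<tau> = Suc i}"

definition face_enum :: "nat set \<Rightarrow> nat \<Rightarrow> nat \<Rightarrow> nat set" where
  "face_enum V i = (SOME e. bij_betw e {..<card (faces V i)} (faces V i))"

lemma finite_faces: "finite V \<Longrightarrow> finite (faces V i)"
  by (rule finite_subset[of _ "Pow V"]) (auto simp: faces_def)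

lemma face_enum:
  assumes "finite V"
  shows "bij_betw (face_enum V i) {..<card (faces V i)} (faces V i)"
proof -
  have "\<exists>e. bij_betw e {..<card (faces V i)} (faces V i)"
    using ex_bij_betw_nat_finite[OF finite_faces[OF assms, of i]] by (simp only: atLeast0LessThan)
  then show ?thesis unfolding face_enum_def by (rule someI_ex)
qed

lemma face_enum_in: "finite V \<Longrightarrow> b < card (faces V i) \<Longrightarrow> face_enum V i b \<in> faces V i"
  using face_enum[of V i] by (auto simp: bij_betw_def)

definition taylor_entry ::
  "(nat \<Rightarrow> 'n::finite monomial) \<Rightarrow> nat set \<Rightarrow> nat set \<Rightarrow> ('n, 'k::field) mpoly" where
  "taylor_entry u \<sigma> \<tau> = (if \<exists>j. j \<notin> \<sigma> \<and> \<tau> = insert j \<sigma>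
     then Poly_Mapping.single (flcm u \<tau> - flcm u \<sigma>) (face_sign (the_elem (\<tau> - \<sigma>)) \<sigma>) else 0)"

lemma taylor_entry_eq_0: "\<nexists>j. j \<notin> \<sigma> \<and> \<tau> = insert j \<sigma> \<Longrightarrow> taylor_entry u \<sigma> \<tau> = 0"
  unfolding taylor_entry_def by (rule if_not_P)

lemma taylor_entry_insert:
  assumes "j \<notin> \<sigma>"
  shows "taylor_entry u \<sigma> (insert j \<sigma>)
    = Poly_Mapping.single (flcm u (insert j \<sigma>) - flcm u \<sigma>) (face_sign j \<sigma>)"
proof -
  have "insert j \<sigma> - \<sigma> = {j}" using assms by auto
  then show ?thesis using assms by (auto simp: taylor_entry_def)
qed

text \<open>This resolves I rather than R/I, so homological degree i is spanned by the subsets of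
  size i + 1.\<close>

definition taylor_complex ::
  "nat set \<Rightarrow> (nat \<Rightarrow> 'n::finite monomial) \<Rightarrow> (('n, 'k::field) mpoly, ('n, 'k) mpoly) free_complex" where
  "taylor_complex V u = \<lparr>
     rk = \<lambda>i. card (faces V i),
     bdeg = \<lambda>i b. int (mdeg (flcm u (face_enum V i b))),
     entry = \<lambda>i c b. taylor_entry u (face_enum V i c) (face_enum V (Suc i) b),
     aug = \<lambda>b. mon (flcm u (face_enum V 0 b))\<rparr>"

text \<open>Coordinates of a family in the chosen enumeration; its values at subsets of other sizes
  are forgotten.\<close>

definition chain_vec :: "nat set \<Rightarrow> nat \<Rightarrow> (nat set \<Rightarrow> 'a::zero) \<Rightarrow> nat \<Rightarrow> 'a" where
  "chain_vec V i f b = (if b < card (faces V i) then f (face_enum V i b) else 0)"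

lemma chain_vec_eq_iff:
  assumes "finite V"
  shows "chain_vec V i f = chain_vec V i g \<longleftrightarrow> (\<forall>\<tau>\<in>faces V i. f \<tau> = g \<tau>)"
proof -
  have "chain_vec V i f = chain_vec V i g \<longleftrightarrow>
      (\<forall>b<card (faces V i). f (face_enum V i b) = g (face_enum V i b))"
    by (auto simp: fun_eq_iff chain_vec_def)
  also have "\<dots> \<longleftrightarrow> (\<forall>\<tau>\<in>face_enum V i ` {..<card (faces V i)}. f \<tau> = g \<tau>)"
    by auto
  also have "\<dots> \<longleftrightarrow> (\<forall>\<tau>\<in>faces V i. f \<tau> = g \<tau>)"
    by (simp only: bij_betw_imp_surj_on[OF face_enum[OF assms]])
  finally show ?thesis .
qed

lemma range_chain_vec:
  assumes "finite V"
  shows "range (chain_vec V i) = (vecs (card (faces V i)) :: (nat \<Rightarrow> 'a::zero) set)"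
proof
  show "range (chain_vec V i) \<subseteq> (vecs (card (faces V i)) :: (nat \<Rightarrow> 'a) set)"
    by (auto simp: chain_vec_def vecs_def)
  show "(vecs (card (faces V i)) :: (nat \<Rightarrow> 'a) set) \<subseteq> range (chain_vec V i)"
  proof
    fix g :: "nat \<Rightarrow> 'a" assume g: "g \<in> vecs (card (faces V i))"
    let ?f = "\<lambda>\<tau>. g (inv_into {..<card (faces V i)} (face_enum V i) \<tau>)"
    have "chain_vec V i ?f b = g b" for b
      using g by (simp add: chain_vec_def vecs_def inv_into_f_f[OF bij_betw_imp_inj_on[OF face_enum[OF assms]]])
    then have "g = chain_vec V i ?f" by auto
    then show "g \<in> range (chain_vec V i)" by (rule range_eqI[of g "chain_vec V i" ?f])
  qed
qed

lemma sum_face_enum: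
  assumes "finite V"
  shows "(\<Sum>b<card (faces V i). A (face_enum V i b)) = (\<Sum>\<tau>\<in>faces V i. A \<tau>)"
  by (rule sum.reindex_bij_betw[OF face_enum[OF assms]])

text \<open>A row of the differential is supported on cofaces, which correspond to the vertices
  outside \<sigma>. The index allows the empty \<sigma> with i = 0, which serves the
  augmentation.\<close>

lemma sum_cofaces:
  assumes V: "finite V" "\<sigma> \<subseteq> V" "card \<sigma> = i"
    and A: "\<And>\<tau>. \<tau> \<in> faces V i \<Longrightarrow> \<nexists>j. j \<notin> \<sigma> \<and> \<tau> = insert j \<sigma> \<Longrightarrow> A \<tau> = 0"
  shows "(\<Sum>\<tau>\<in>faces V i. A \<tau>) = (\<Sum>j\<in>V - \<sigma>. A (insert j \<sigma>))"
proof -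
  have fin: "finite \<sigma>" using V finite_subset by auto
  have inj: "inj_on (\<lambda>j. insert j \<sigma>) (V - \<sigma>)" by (auto simp: inj_on_def)
  have "(\<Sum>\<tau>\<in>faces V i. A \<tau>) = (\<Sum>\<tau>\<in>(\<lambda>j. insert j \<sigma>) ` (V - \<sigma>). A \<tau>)"
  proof (rule sum.mono_neutral_right)
    show "(\<lambda>j. insert j \<sigma>) ` (V - \<sigma>) \<subseteq> faces V i" using V fin by (auto simp: faces_def)
    show "\<forall>\<tau>\<in>faces V i - (\<lambda>j. insert j \<sigma>) ` (V - \<sigma>). A \<tau> = 0"
    proof
      fix \<tau> assume \<tau>: "\<tau> \<in> faces V i - (\<lambda>j. insert j \<sigma>) ` (V - \<sigma>)"
      then show "A \<tau> = 0" by (intro A) (auto simp: faces_def)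
    qed
  qed (rule finite_faces[OF V(1)])
  also have "\<dots> = (\<Sum>j\<in>V - \<sigma>. A (insert j \<sigma>))" by (simp add: sum.reindex[OF inj])
  finally show ?thesis .
qed

lemma differential_taylor_complex:
  assumes V: "finite V"
  shows "differential (taylor_complex V u) i (chain_vec V (Suc i) f) = chain_vec V i (taylor_boundary V u f)"
proof
  fix c
  show "differential (taylor_complex V u) i (chain_vec V (Suc i) f) c = chain_vec V i (taylor_boundary V u f) c"
  proof (cases "c < card (faces V i)")
    case True
    let ?\<sigma> = "face_enum V i c"
    have \<sigma>: "?\<sigma> \<subseteq> V" "card ?\<sigma> = Suc i" using face_enum_in[OF V True] by (auto simp: faces_def)
    have "differential (taylor_complex V u) i (chain_vec V (Suc i) f) c
        = (\<Sum>b<card (faces V (Suc i)). taylor_entry u ?\<sigma> (face_enum V (Suc i) b) * f (face_enum V (Suc i) b))"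
      using True by (simp add: differential_def mat_app_def taylor_complex_def chain_vec_def)
    also have "\<dots> = (\<Sum>\<tau>\<in>faces V (Suc i). taylor_entry u ?\<sigma> \<tau> * f \<tau>)"
      by (rule sum_face_enum[OF V, of "\<lambda>\<tau>. taylor_entry u ?\<sigma> \<tau> * f \<tau>"])
    also have "\<dots> = (\<Sum>j\<in>V - ?\<sigma>. taylor_entry u ?\<sigma> (insert j ?\<sigma>) * f (insert j ?\<sigma>))"
      by (rule sum_cofaces[OF V \<sigma>]) (simp add: taylor_entry_eq_0)
    also have "\<dots> = taylor_boundary V u f ?\<sigma>"
      unfolding taylor_boundary_def by (intro sum.cong) (simp_all add: taylor_entry_insert)
    finally show ?thesis using True by (simp add: chain_vec_def)
  qed (simp add: differential_def mat_app_def taylor_complex_def chain_vec_def)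
qed

text \<open>The empty face has lcm 1 and sign 1, so the augmentation is the same formula as the
  differential, and one contraction proves both surjectivity and exactness.\<close>

lemma augment_taylor_complex:
  assumes V: "finite V"
  shows "augment (*) (taylor_complex V u) (chain_vec V 0 f) = taylor_boundary V u f {}"
proof -
  have "augment (*) (taylor_complex V u) (chain_vec V 0 f)
      = (\<Sum>b<card (faces V 0). mon (flcm u (face_enum V 0 b)) * f (face_enum V 0 b))"
    by (simp add: augment_def taylor_complex_def chain_vec_def mult.commute)
  also have "\<dots> = (\<Sum>\<tau>\<in>faces V 0. mon (flcm u \<tau>) * f \<tau>)"
    by (rule sum_face_enum[OF V, of "\<lambda>\<tau>. mon (flcm u \<tau>) * f \<tau>"])
  also have "\<dots> = (\<Sum>j\<in>V - {}. mon (flcm u (insert j {})) * f (insert j {}))"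
    by (rule sum_cofaces[OF V]) (auto simp: faces_def card_Suc_eq)
  also have "\<dots> = taylor_boundary V u f {}"
    by (simp add: taylor_boundary_def mon_def face_sign_def)
  finally show ?thesis .
qed

lemma homogeneous_single: "homogeneous (int (mdeg t)) (Poly_Mapping.single t a)"
  by (simp add: homogeneous_def)

theorem taylor_resolution:
  fixes u :: "nat \<Rightarrow> 'n::finite monomial"
  assumes V: "finite V"
  shows "graded_free_resolution (*) (\<lambda>j. {p. homogeneous j p}) (ideal_of (mon ` u ` V))
           (taylor_complex V u :: (('n, 'k::field) mpoly, ('n, 'k) mpoly) free_complex)"
proof -
  let ?T = "taylor_complex V u :: (('n, 'k::field) mpoly, ('n, 'k) mpoly) free_complex"
  let ?I = "ideal_of (mon ` u ` V) :: ('n, 'k) mpoly set"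
  have chain: "chain_module ?T i = range (chain_vec V i)" for i
    by (simp add: chain_module_def range_chain_vec[OF V] vecs_def taylor_complex_def)
  have zero: "chain_vec V i f = 0 \<longleftrightarrow> (\<forall>\<tau>\<in>faces V i. f \<tau> = 0)" for i and f :: "nat set \<Rightarrow> ('n, 'k) mpoly"
  proof -
    have "chain_vec V i (\<lambda>_. 0) = (0 :: nat \<Rightarrow> ('n, 'k) mpoly)" by (auto simp: chain_vec_def)
    then show ?thesis using chain_vec_eq_iff[OF V, of i f "\<lambda>_. 0"] by simp
  qed
  have fin: "finite \<tau>" if "\<tau> \<in> faces V i" for \<tau> i
    using that by (auto simp: faces_def intro: card_ge_0_finite)
  \<comment> \<open>Faces are nonempty, so the ideal condition of
    \<open>taylor_boundary_contraction\<close> is vacuous here.\<close>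
  have lift: "chain_vec V i f = chain_vec V i (taylor_boundary V u (taylor_contraction V u f))"
    if "\<And>\<sigma> j. \<sigma> \<in> faces V i \<Longrightarrow> j \<in> \<sigma> \<Longrightarrow> taylor_boundary V u f (\<sigma> - {j}) = 0"
    for i and f :: "nat set \<Rightarrow> ('n, 'k) mpoly"
    unfolding chain_vec_eq_iff[OF V]
  proof
    fix \<tau> assume \<tau>: "\<tau> \<in> faces V i"
    have "taylor_boundary V u (taylor_contraction V u f) \<tau> = f \<tau>"
      by (rule taylor_boundary_contraction[OF V]) (use \<tau> that[OF \<tau>] in \<open>auto simp: faces_def\<close>)
    then show "f \<tau> = taylor_boundary V u (taylor_contraction V u f) \<tau>" by simp
  qed
  have aug: "aug ?T b \<in> ?I \<inter> {p. homogeneous (bdeg ?T 0 b) p}" if "b < rk ?T 0" for b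
  proof -
    from that have "face_enum V 0 b \<in> faces V 0"
      by (intro face_enum_in V) (simp add: taylor_complex_def)
    then obtain j where "face_enum V 0 b = {j}" "j \<in> V" by (auto simp: faces_def card_Suc_eq)
    then show ?thesis
      using mle_mlcm[of "{u j}" "u j"]
      by (auto simp: taylor_complex_def mon_in_ideal_of_mon_iff) (simp add: mon_def homogeneous_single)
  qed
  have hom: "homogeneous (bdeg ?T (Suc i) b - bdeg ?T i c) (entry ?T i c b)"
    if "c < rk ?T i" "b < rk ?T (Suc i)" for i b c
  proof -
    let ?\<sigma> = "face_enum V i c" and ?\<tau> = "face_enum V (Suc i) b"
    have f: "finite ?\<sigma>" "finite ?\<tau>"
      using that by (auto intro!: fin face_enum_in[OF V] simp: taylor_complex_def)
    show ?thesis
    proof (cases "\<exists>j. j \<notin> ?\<sigma> \<and> ?\<tau> = insert j ?\<sigma>")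
      case True
      then have le: "mle (flcm u ?\<sigma>) (flcm u ?\<tau>)" using f by (intro mlcm_mono) auto
      have "int (mdeg (flcm u ?\<tau>)) - int (mdeg (flcm u ?\<sigma>)) = int (mdeg (flcm u ?\<tau> - flcm u ?\<sigma>))"
        using mdeg_mono[OF le] by (simp add: mdeg_diff[OF le])
      then show ?thesis using True by (simp add: taylor_complex_def taylor_entry_def homogeneous_single)
    next
      case False
      then have "taylor_entry u ?\<sigma> ?\<tau> = (0 :: ('n, 'k) mpoly)" by (rule taylor_entry_eq_0)
      then show ?thesis by (simp add: taylor_complex_def)
    qed
  qed
  have surj: "augment (*) ?T ` chain_module ?T 0 = ?I"
  proof
    show "augment (*) ?T ` chain_module ?T 0 \<subseteq> ?I"
    proof -
      interpret module "(*) :: ('n, 'k) mpoly \<Rightarrow> _"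
        by unfold_locales (simp_all add: algebra_simps)
      have "augment (*) ?T f \<in> ?I" for f
        unfolding augment_def ideal_of_def
        by (intro span_sum span_scale) (use aug in \<open>auto simp: ideal_of_def\<close>)
      then show ?thesis by blast
    qed
    show "?I \<subseteq> augment (*) ?T ` chain_module ?T 0"
    proof
      fix p assume p: "p \<in> ?I"
      \<comment> \<open>At the empty face there is no cycle condition, and only the value p of the
        constant family at the empty set enters.\<close>
      have "taylor_boundary V u (taylor_contraction V u (\<lambda>_. p)) {} = p"
        using p by (subst taylor_boundary_contraction[OF V]) auto
      then have "p = augment (*) ?T (chain_vec V 0 (taylor_contraction V u (\<lambda>_. p)))"
        by (simp add: augment_taylor_complex[OF V])
      then show "p \<in> augment (*) ?T ` chain_module ?T 0" by (simp add: chain)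
    qed
  qed
  have ex0: "{f \<in> chain_module ?T 0. augment (*) ?T f = 0} = differential ?T 0 ` chain_module ?T 1"
  proof (intro equalityI subsetI)
    fix g assume "g \<in> {f \<in> chain_module ?T 0. augment (*) ?T f = 0}"
    then obtain f where f: "g = chain_vec V 0 f" "taylor_boundary V u f {} = 0"
      by (auto simp: chain augment_taylor_complex[OF V])
    have "g = chain_vec V 0 (taylor_boundary V u (taylor_contraction V u f))"
      unfolding f(1) by (rule lift) (use f(2) in \<open>auto simp: faces_def card_Suc_eq\<close>)
    then show "g \<in> differential ?T 0 ` chain_module ?T 1"
      by (simp add: chain differential_taylor_complex[OF V, symmetric])
  next
    fix g assume "g \<in> differential ?T 0 ` chain_module ?T 1"
    then obtain f where "g = chain_vec V 0 (taylor_boundary V u f)"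
      by (auto simp: chain differential_taylor_complex[OF V])
    then show "g \<in> {f \<in> chain_module ?T 0. augment (*) ?T f = 0}"
      by (simp add: chain augment_taylor_complex[OF V] taylor_boundary_boundary[OF V])
  qed
  have ex: "{f \<in> chain_module ?T (Suc i). differential ?T i f = 0}
      = differential ?T (Suc i) ` chain_module ?T (Suc (Suc i))" for i
  proof (intro equalityI subsetI)
    fix g assume "g \<in> {f \<in> chain_module ?T (Suc i). differential ?T i f = 0}"
    then obtain f where f: "g = chain_vec V (Suc i) f" "\<And>\<tau>. \<tau> \<in> faces V i \<Longrightarrow> taylor_boundary V u f \<tau> = 0"
      by (auto simp: chain differential_taylor_complex[OF V] zero)
    have "g = chain_vec V (Suc i) (taylor_boundary V u (taylor_contraction V u f))"
      unfolding f(1)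
    proof (rule lift)
      fix \<sigma> j assume "\<sigma> \<in> faces V (Suc i)" "j \<in> \<sigma>"
      then show "taylor_boundary V u f (\<sigma> - {j}) = 0"
        using fin[of \<sigma> "Suc i"] by (intro f(2)) (auto simp: faces_def)
    qed
    then show "g \<in> differential ?T (Suc i) ` chain_module ?T (Suc (Suc i))"
      by (simp add: chain differential_taylor_complex[OF V, symmetric])
  next
    fix g assume "g \<in> differential ?T (Suc i) ` chain_module ?T (Suc (Suc i))"
    then obtain f where "g = chain_vec V (Suc i) (taylor_boundary V u f)"
      by (auto simp: chain differential_taylor_complex[OF V])
    moreover have "chain_vec V i (taylor_boundary V u (taylor_boundary V u f)) = 0"
      unfolding zero by (auto simp: faces_def taylor_boundary_boundary[OF V])
    ultimately show "g \<in> {f \<in> chain_module ?T (Suc i). differential ?T i f = 0}"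
      by (simp add: chain differential_taylor_complex[OF V])
  qed
  show ?thesis unfolding graded_free_resolution_def by (intro conjI allI impI aug hom surj ex0 ex)
qed


section \<open>Regularity from the Taylor resolution\<close>

lemma diff_k_taylor_complex:
  fixes u :: "nat \<Rightarrow> 'n::finite monomial" and v :: "nat set \<Rightarrow> 'k::field"
  assumes V: "finite V"
  shows "diff_k (taylor_complex V u :: (('n, 'k) mpoly, ('n, 'k) mpoly) free_complex) i (chain_vec V (Suc i) v)
    = chain_vec V i (\<lambda>\<sigma>. \<Sum>j\<in>V - \<sigma>. if flcm u (insert j \<sigma>) = flcm u \<sigma>
         then face_sign j \<sigma> * v (insert j \<sigma>) else 0)" (is "diff_k ?T i ?v = chain_vec V i ?D")
proof
  fix c
  let ?E = "\<lambda>\<sigma> \<tau>. Poly_Mapping.lookup (taylor_entry u \<sigma> \<tau> :: ('n, 'k) mpoly) 0"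
  show "diff_k ?T i ?v c = chain_vec V i ?D c"
  proof (cases "c < card (faces V i)")
    case True
    let ?\<sigma> = "face_enum V i c"
    have \<sigma>: "?\<sigma> \<subseteq> V" "card ?\<sigma> = Suc i" using face_enum_in[OF V True] by (auto simp: faces_def)
    have "diff_k ?T i ?v c
        = (\<Sum>b<card (faces V (Suc i)). ?E ?\<sigma> (face_enum V (Suc i) b) * v (face_enum V (Suc i) b))"
      using True by (simp add: diff_k_def mat_app_def taylor_complex_def chain_vec_def)
    also have "\<dots> = (\<Sum>\<tau>\<in>faces V (Suc i). ?E ?\<sigma> \<tau> * v \<tau>)"
      by (rule sum_face_enum[OF V, of "\<lambda>\<tau>. ?E ?\<sigma> \<tau> * v \<tau>"])
    also have "\<dots> = (\<Sum>j\<in>V - ?\<sigma>. ?E ?\<sigma> (insert j ?\<sigma>) * v (insert j ?\<sigma>))"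
      by (rule sum_cofaces[OF V \<sigma>]) (simp add: taylor_entry_eq_0)
    also have "\<dots> = ?D ?\<sigma>"
    proof (rule sum.cong)
      fix j assume j: "j \<in> V - ?\<sigma>"
      have "mle (flcm u ?\<sigma>) (flcm u (insert j ?\<sigma>))"
        using finite_subset[OF \<sigma>(1) V] by (intro mlcm_mono) auto
      then have "flcm u (insert j ?\<sigma>) - flcm u ?\<sigma> = 0 \<longleftrightarrow> flcm u (insert j ?\<sigma>) = flcm u ?\<sigma>"
        unfolding mle_diff_eq_0_iff using mle_antisym mle_refl by metis
      moreover have "?E ?\<sigma> (insert j ?\<sigma>) = (face_sign j ?\<sigma> when flcm u (insert j ?\<sigma>) - flcm u ?\<sigma> = 0)"
        using j by (simp add: taylor_entry_insert lookup_single)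
      ultimately show "?E ?\<sigma> (insert j ?\<sigma>) * v (insert j ?\<sigma>)
        = (if flcm u (insert j ?\<sigma>) = flcm u ?\<sigma> then face_sign j ?\<sigma> * v (insert j ?\<sigma>) else 0)"
        by (simp del: image_insert add: when_def)
    qed simp
    finally show ?thesis using True by (simp add: chain_vec_def)
  qed (simp add: diff_k_def mat_app_def taylor_complex_def chain_vec_def)
qed

lemma chain_vec_in_tensor_k_iff:
  fixes u :: "nat \<Rightarrow> 'n::finite monomial" and v :: "nat set \<Rightarrow> 'k::field"
  assumes V: "finite V"
  shows "chain_vec V i v \<in> tensor_k (taylor_complex V u :: (('n, 'k) mpoly, ('n, 'k) mpoly) free_complex) i d
    \<longleftrightarrow> (\<forall>\<tau>\<in>faces V i. v \<tau> \<noteq> 0 \<longrightarrow> int (mdeg (flcm u \<tau>)) = d)"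
proof -
  have "?thesis \<longleftrightarrow> ((\<forall>\<tau>\<in>face_enum V i ` {..<card (faces V i)}. v \<tau> \<noteq> 0 \<longrightarrow> int (mdeg (flcm u \<tau>)) = d)
      \<longleftrightarrow> (\<forall>\<tau>\<in>faces V i. v \<tau> \<noteq> 0 \<longrightarrow> int (mdeg (flcm u \<tau>)) = d))"
    by (auto simp: tensor_k_def taylor_complex_def chain_vec_def split: if_splits)
  then show ?thesis by (simp only: bij_betw_imp_surj_on[OF face_enum[OF V]])
qed

lemma tensor_k_taylor_complexE:
  fixes u :: "nat \<Rightarrow> 'n::finite monomial" and w :: "nat \<Rightarrow> 'k::field"
  assumes "finite V" "w \<in> tensor_k (taylor_complex V u :: (('n, 'k) mpoly, ('n, 'k) mpoly) free_complex) i d"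
  obtains v where "w = chain_vec V i v"
  using tensor_k_in_vecs[OF assms(2)] range_chain_vec[OF assms(1), where 'a = 'k, of i]
  by (auto simp: taylor_complex_def)

text \<open>
  If passing from \<open>\<sigma>\<close> to \<open>insert j \<sigma>\<close> leaves the lcm unchanged only for \<open>j = p\<close> and \<open>Q \<sigma>\<close>, then modulo the
  variables the Taylor complex splits into the isomorphisms \<open>insert p \<sigma> \<mapsto> \<sigma>\<close> with \<open>Q \<sigma>\<close> and a complex with
  zero differential.
\<close>

lemma tor_vanishing_taylor_complex:
  fixes u :: "nat \<Rightarrow> 'n::finite monomial" and V :: "nat set"
  defines "T \<equiv> taylor_complex V u :: (('n, 'k::field) mpoly, ('n, 'k) mpoly) free_complex"
  assumes V: "finite V"
    and crit: "\<And>\<sigma> j. \<sigma> \<subseteq> V \<Longrightarrow> j \<in> V - \<sigma> \<Longrightarrow> flcm u (insert j \<sigma>) = flcm u \<sigma> \<longleftrightarrow> j = p \<and> Q \<sigma>"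
    and p: "\<And>\<sigma>. Q \<sigma> \<Longrightarrow> p \<in> V" and empty: "\<not> Q {}"
  shows "tor_cycles T i d \<subseteq> tor_boundaries T i d
    \<longleftrightarrow> (\<forall>\<tau>\<in>faces V i. int (mdeg (flcm u \<tau>)) = d \<longrightarrow> Q (\<tau> - {p}))"
proof -
  \<comment> \<open>The Taylor differential modulo the variables: by \<open>crit\<close>, only the
    vertex \<open>p\<close> can be inserted.\<close>
  define D :: "(nat set \<Rightarrow> 'k) \<Rightarrow> nat set \<Rightarrow> 'k"
    where "D v \<sigma> = (if p \<notin> \<sigma> \<and> Q \<sigma> then face_sign p \<sigma> * v (insert p \<sigma>) else 0)" for v \<sigma>
  have zero: "chain_vec V i v = 0 \<longleftrightarrow> (\<forall>\<tau>\<in>faces V i. v \<tau> = 0)" for i and v :: "nat set \<Rightarrow> 'k"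
  proof -
    have "chain_vec V i (\<lambda>_. 0) = (0 :: nat \<Rightarrow> 'k)" by (auto simp: chain_vec_def)
    then show ?thesis using chain_vec_eq_iff[OF V, of i v "\<lambda>_. 0"] by simp
  qed
  have diff: "diff_k T i (chain_vec V (Suc i) v) = chain_vec V i (D v)" for i v
    unfolding T_def diff_k_taylor_complex[OF V] chain_vec_eq_iff[OF V]
  proof
    fix \<sigma> assume "\<sigma> \<in> faces V i"
    then have \<sigma>: "\<sigma> \<subseteq> V" by (simp add: faces_def)
    have "(\<Sum>j\<in>V - \<sigma>. if flcm u (insert j \<sigma>) = flcm u \<sigma> then face_sign j \<sigma> * v (insert j \<sigma>) else 0)
        = (\<Sum>j\<in>V - \<sigma>. if j = p then (if Q \<sigma> then face_sign p \<sigma> * v (insert p \<sigma>) else 0) else 0)"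
      by (intro sum.cong refl) (auto simp: crit[OF \<sigma>] simp del: image_insert)
    also have "\<dots> = D v \<sigma>" using V p by (auto simp: D_def)
    finally show "(\<Sum>j\<in>V - \<sigma>. if flcm u (insert j \<sigma>) = flcm u \<sigma> then face_sign j \<sigma> * v (insert j \<sigma>) else 0) = D v \<sigma>" .
  qed
  have fin: "finite \<tau>" if "\<tau> \<in> faces V i" for \<tau> i
    using that by (auto simp: faces_def intro: card_ge_0_finite)
  show ?thesis
  proof
    assume van: "tor_cycles T i d \<subseteq> tor_boundaries T i d"
    show "\<forall>\<tau>\<in>faces V i. int (mdeg (flcm u \<tau>)) = d \<longrightarrow> Q (\<tau> - {p})"
    proof (intro ballI impI, rule ccontr)
      fix \<tau> assume \<tau>: "\<tau> \<in> faces V i" "int (mdeg (flcm u \<tau>)) = d" "\<not> Q (\<tau> - {p})"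
      \<comment> \<open>The basis vector of \<tau>. A nonzero value of \<open>D v\<close>, or of any
        \<open>D v'\<close> at \<tau>, would force Q (\<tau> - {p}); so it is a cycle but not a
        boundary.\<close>
      define v :: "nat set \<Rightarrow> 'k" where "v = (\<lambda>\<rho>. if \<rho> = \<tau> then 1 else 0)"
      have "D v \<sigma> = 0" for \<sigma>
        using \<tau>(3) by (auto simp: D_def v_def)
      then have "chain_vec V i v \<in> tor_cycles T i d"
        using \<tau>(2) unfolding tor_cycles_def T_def
        by (auto simp: chain_vec_in_tensor_k_iff[OF V] v_def diff[unfolded T_def] zero)
      then obtain w where w: "w \<in> tensor_k T (Suc i) d" "chain_vec V i v = diff_k T i w"
        using van by (auto simp: tor_boundaries_def)
      obtain v' where "w = chain_vec V (Suc i) v'"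
        using w(1) unfolding T_def by (rule tensor_k_taylor_complexE[OF V])
      then have "v \<tau> = D v' \<tau>" using w(2) \<tau>(1) by (simp add: diff chain_vec_eq_iff[OF V])
      then show False using \<tau>(3) by (simp add: v_def D_def split: if_splits)
    qed
  next
    assume van: "\<forall>\<tau>\<in>faces V i. int (mdeg (flcm u \<tau>)) = d \<longrightarrow> Q (\<tau> - {p})"
    show "tor_cycles T i d \<subseteq> tor_boundaries T i d"
    proof
      fix w assume w: "w \<in> tor_cycles T i d"
      obtain v where v: "w = chain_vec V i v"
        using w unfolding T_def tor_cycles_def by (blast elim: tensor_k_taylor_complexE[OF V])
      have deg: "int (mdeg (flcm u \<tau>)) = d" if "\<tau> \<in> faces V i" "v \<tau> \<noteq> 0" for \<tau>
        using w that by (simp add: tor_cycles_def T_def v chain_vec_in_tensor_k_iff[OF V])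
      \<comment> \<open>Where Q (\<tau> - {p}) holds, v \<tau> is up to sign the value of
        \<open>D v\<close> at \<tau> - {p}, so a cycle vanishes on faces containing p.\<close>
      have vp: "v \<tau> = 0" if \<tau>: "\<tau> \<in> faces V i" "p \<in> \<tau>" for \<tau>
      proof (rule ccontr)
        assume nz: "v \<tau> \<noteq> 0"
        then have Q: "Q (\<tau> - {p})" using van deg \<tau> by blast
        show False
        proof (cases i)
          \<comment> \<open>In degree 0 every vector is a cycle; the only face through p is {p}, and
            \<open>empty\<close> rules it out.\<close>
          case 0
          then have "\<tau> = {p}" using \<tau> by (auto simp: faces_def card_Suc_eq)
          then show ?thesis using Q empty by simp
        next
          case (Suc i')
          have "chain_vec V i' (D v) = 0" using w unfolding tor_cycles_def v Suc by (simp add: diff)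
          moreover have "\<tau> - {p} \<in> faces V i'" using \<tau> Suc fin[OF \<tau>(1)] by (auto simp: faces_def)
          ultimately have "D v (\<tau> - {p}) = 0" by (simp add: zero)
          then have "face_sign p (\<tau> - {p}) * v \<tau> = 0"
            using Q \<tau>(2) by (simp add: D_def insert_absorb)
          from arg_cong[OF this, of "(*) (face_sign p (\<tau> - {p}))"] show ?thesis
            using nz by (simp only: face_sign_sq mult_zero_right)
        qed
      qed
      \<comment> \<open>The inverse of the isomorphisms \<open>insert p\<close> \<sigma> to
        \<sigma>, with the same sign because signs square to 1.\<close>
      define v' where "v' \<rho> = (if p \<in> \<rho> \<and> Q (\<rho> - {p}) then face_sign p (\<rho> - {p}) * v (\<rho> - {p}) else 0)" for \<rho>
      have "chain_vec V (Suc i) v' \<in> tensor_k T (Suc i) d"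
        unfolding T_def chain_vec_in_tensor_k_iff[OF V]
      proof (intro ballI impI)
        fix \<rho> assume \<rho>: "\<rho> \<in> faces V (Suc i)" "v' \<rho> \<noteq> 0"
        then have 1: "p \<in> \<rho>" "Q (\<rho> - {p})" "v (\<rho> - {p}) \<noteq> 0" by (auto simp: v'_def split: if_splits)
        then have f: "\<rho> - {p} \<in> faces V i" using \<rho>(1) fin[OF \<rho>(1)] by (auto simp: faces_def)
        have "flcm u (insert p (\<rho> - {p})) = flcm u (\<rho> - {p})"
          using 1 \<rho>(1) by (subst crit) (auto simp: faces_def)
        then have "flcm u \<rho> = flcm u (\<rho> - {p})" using 1(1) by (simp only: insert_Diff)
        then show "int (mdeg (flcm u \<rho>)) = d" using deg[OF f 1(3)] by simp
      qed
      moreover have "w = diff_k T i (chain_vec V (Suc i) v')"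
        unfolding v diff chain_vec_eq_iff[OF V]
      proof
        fix \<tau> assume \<tau>: "\<tau> \<in> faces V i"
        show "v \<tau> = D v' \<tau>"
        proof (cases "p \<in> \<tau> \<or> v \<tau> = 0")
          case True
          then show ?thesis using vp[OF \<tau>] by (auto simp: D_def v'_def)
        next
          case False
          then have "Q \<tau>" using van deg[OF \<tau>] \<tau> by auto
          then show ?thesis using False by (simp add: D_def v'_def)
        qed
      qed
      ultimately show "w \<in> tor_boundaries T i d" unfolding tor_boundaries_def by blast
    qed
  qed
qed

text \<open>A surviving \<tau> lives in homological degree |\<tau>| - 1, which gives the summand +
  1. Keeping \<open>p\<close> and \<open>Q\<close> abstract lets the minimal Taylor complex be the
  instance with \<open>Q\<close> constantly false.\<close>

lemma reg_from_taylor: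
  fixes u :: "nat \<Rightarrow> 'n::finite monomial"
  assumes V: "finite V"
    and crit: "\<And>\<sigma> j. \<sigma> \<subseteq> V \<Longrightarrow> j \<in> V - \<sigma> \<Longrightarrow> flcm u (insert j \<sigma>) = flcm u \<sigma> \<longleftrightarrow> j = p \<and> Q \<sigma>"
    and p: "\<And>\<sigma>. Q \<sigma> \<Longrightarrow> p \<in> V" and empty: "\<not> Q {}"
  shows "reg (ideal_of (mon ` u ` V) :: ('n, 'k::field) mpoly set)
    = Max ((\<lambda>\<tau>. int (mdeg (flcm u \<tau>)) - int (card \<tau>) + 1) ` {\<tau>. \<tau> \<subseteq> V \<and> \<tau> \<noteq> {} \<and> \<not> Q (\<tau> - {p})})"
proof -
  let ?I = "ideal_of (mon ` u ` V) :: ('n, 'k) mpoly set"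
  let ?\<beta> = "betti (*) (\<lambda>j. {p. homogeneous j p}) ?I"
  have \<beta>: "?\<beta> i j \<noteq> 0 \<longleftrightarrow> (\<exists>\<tau>\<in>faces V i. int (mdeg (flcm u \<tau>)) = j \<and> \<not> Q (\<tau> - {p}))" for i j
  proof -
    let ?T = "taylor_complex V u :: (('n, 'k) mpoly, ('n, 'k) mpoly) free_complex"
    have "tor_cycles ?T i j \<subseteq> tor_boundaries ?T i j
        \<longleftrightarrow> (\<forall>\<tau>\<in>faces V i. int (mdeg (flcm u \<tau>)) = j \<longrightarrow> Q (\<tau> - {p}))"
      using V crit p empty by (rule tor_vanishing_taylor_complex)
    then show ?thesis unfolding betti_eq_0_iff[OF taylor_resolution[OF V]] by blast
  qed
  have "{j - int i | i j. ?\<beta> i j \<noteq> 0}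
      = (\<lambda>\<tau>. int (mdeg (flcm u \<tau>)) - int (card \<tau>) + 1) ` {\<tau>. \<tau> \<subseteq> V \<and> \<tau> \<noteq> {} \<and> \<not> Q (\<tau> - {p})}"
    (is "?L = ?f ` ?R")
  proof (intro equalityI subsetI)
    fix x assume "x \<in> ?L"
    then obtain i \<tau> where "\<tau> \<in> faces V i" "x = int (mdeg (flcm u \<tau>)) - int i" "\<not> Q (\<tau> - {p})"
      unfolding \<beta> by blast
    then have "\<tau> \<in> ?R" "x = ?f \<tau>" by (auto simp: faces_def)
    then show "x \<in> ?f ` ?R" by blast
  next
    fix x assume "x \<in> ?f ` ?R"
    then obtain \<tau> where \<tau>: "\<tau> \<in> ?R" "x = ?f \<tau>" by blast
    then have "card \<tau> \<noteq> 0" using V finite_subset[of \<tau> V] by auto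
    then obtain i where i: "card \<tau> = Suc i" using not0_implies_Suc by blast
    then have "?\<beta> i (int (mdeg (flcm u \<tau>))) \<noteq> 0" "x = int (mdeg (flcm u \<tau>)) - int i"
      using \<tau> unfolding \<beta> by (auto simp: faces_def)
    then show "x \<in> ?L" by blast
  qed
  then show ?thesis by (simp add: reg_def regularity_def)
qed


section \<open>Almost complete intersections\<close>

lemma lookup_mlcm_le_iff:
  "finite S \<Longrightarrow> Poly_Mapping.lookup (mlcm S) x \<le> n \<longleftrightarrow> (\<forall>s\<in>S. Poly_Mapping.lookup s x \<le> n)"
  by (induction S rule: finite_induct) (auto simp: lookup_mlcm_insert)

text \<open>Positivity of \<open>n\<close> excludes the default value 0 inside the maximum.\<close>

lemma le_lookup_mlcm_iff:
  assumes "finite S" "0 < n"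
  shows "n \<le> Poly_Mapping.lookup (mlcm S) x \<longleftrightarrow> (\<exists>s\<in>S. n \<le> Poly_Mapping.lookup s x)"
proof -
  have *: "n \<le> a \<longleftrightarrow> \<not> a \<le> n - 1" for a
    using assms(2) by linarith
  show ?thesis unfolding * lookup_mlcm_le_iff[OF assms(1)] by blast
qed

lemma lookup_mgcd: "Poly_Mapping.lookup (mgcd s t) x = min (Poly_Mapping.lookup s x) (Poly_Mapping.lookup t x)"
  by (simp add: mgcd.rep_eq)

lemma mgcd_mle: "mle (mgcd s t) s"
  by (simp add: mle_def lookup_mgcd)

text \<open>Vertices are added one at a time: a changed lcm is a proper multiple, so its degree
  grows by at least the 1 by which the cardinality grows. The inequality uses sums because both
  quantities are natural numbers.\<close>

lemma mdeg_diff_card_mono: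
  fixes u :: "nat \<Rightarrow> 'n::finite monomial"
  assumes fin: "finite \<tau>'" and sub: "\<tau> \<subseteq> \<tau>'"
    and strict: "\<And>\<sigma> j. \<tau> \<subseteq> \<sigma> \<Longrightarrow> insert j \<sigma> \<subseteq> \<tau>' \<Longrightarrow> j \<notin> \<sigma> \<Longrightarrow> flcm u (insert j \<sigma>) \<noteq> flcm u \<sigma>"
  shows "mdeg (flcm u \<tau>) + card \<tau>' \<le> mdeg (flcm u \<tau>') + card \<tau>"
proof -
  have finB: "finite (\<tau>' - \<tau>)" using fin by simp
  have "mdeg (flcm u \<tau>) + card (\<tau> \<union> B) \<le> mdeg (flcm u (\<tau> \<union> B)) + card \<tau>"
    if "finite B" "B \<subseteq> \<tau>' - \<tau>" for B
    using that
  proof (induction B rule: finite_induct)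
    case (insert j B)
    let ?\<sigma> = "\<tau> \<union> B"
    have f: "finite ?\<sigma>" "j \<notin> ?\<sigma>" using insert sub fin finite_subset[of \<tau> \<tau>'] by auto
    have le: "mle (flcm u ?\<sigma>) (flcm u (insert j ?\<sigma>))" using f by (intro mlcm_mono) auto
    have "flcm u (insert j ?\<sigma>) \<noteq> flcm u ?\<sigma>" using insert.prems sub f by (intro strict) auto
    then have "flcm u (insert j ?\<sigma>) - flcm u ?\<sigma> \<noteq> 0"
      using le mle_antisym unfolding mle_diff_eq_0_iff by blast
    then have "mdeg (flcm u (insert j ?\<sigma>) - flcm u ?\<sigma>) \<noteq> 0" by (simp only: mdeg_eq_0_iff not_False_eq_True)
    then have "mdeg (flcm u ?\<sigma>) < mdeg (flcm u (insert j ?\<sigma>))" unfolding mdeg_diff[OF le] by linarith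
    moreover have "card (insert j ?\<sigma>) = Suc (card ?\<sigma>)" using f by simp
    moreover have "mdeg (flcm u \<tau>) + card ?\<sigma> \<le> mdeg (flcm u ?\<sigma>) + card \<tau>"
      using insert.prems by (intro insert.IH) auto
    ultimately show ?case unfolding Un_insert_right by linarith
  qed simp
  from this[OF finB] show ?thesis using sub by (simp add: Un_absorb1)
qed

text \<open>What the combinatorics uses of an almost complete intersection, free of the coefficient
  field.\<close>

locale monomial_aci =
  fixes u :: "nat \<Rightarrow> 'n::finite monomial" and q :: nat
  assumes minimal: "\<And>i j. i \<in> {1..q+1} \<Longrightarrow> j \<in> {1..q+1} \<Longrightarrow> i \<noteq> j \<Longrightarrow> \<not> mle (u i) (u j)"
    and coprime: "\<And>i j x. i \<in> {1..q} \<Longrightarrow> j \<in> {1..q} \<Longrightarrow> i \<noteq> j \<Longrightarrow>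
        Poly_Mapping.lookup (u i) x = 0 \<or> Poly_Mapping.lookup (u j) x = 0"

text \<open>Minimality: a generator divisible by another could be dropped. Coprimality for i < j:
  u_i / gcd(u_i, u_j) times u_j is a multiple of u_i, so regularity puts u_i / gcd(u_i, u_j) into
  (u_1, ..., u_{j-1}). Some u_l with l < j divides it, hence divides u_i; so l = i, and the gcd is
  1.\<close>

lemma monomial_aciI:
  fixes I :: "('n::finite, 'k::field) mpoly set"
  assumes aci: "almost_complete_intersection I q u"
  shows "monomial_aci u q"
proof -
  let ?G = "u ` {1..q+1}"
  have inj: "inj_on u {1..q+1}" and gen: "ideal_of (mon ` ?G) = I"
    and min: "\<And>H. H \<subset> ?G \<Longrightarrow> ideal_of (mon ` H) \<noteq> I"
    and reg: "regular_sequence (map (\<lambda>j. mon (u j) :: ('n, 'k) mpoly) [1..<q+1])" (is "regular_sequence ?fs")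
    using aci by (auto simp: almost_complete_intersection_def minimal_monomial_generators_def)
  have minimal: "\<not> mle (u i) (u j)" if ij: "i \<in> {1..q+1}" "j \<in> {1..q+1}" "i \<noteq> j" for i j
  proof
    assume le: "mle (u i) (u j)"
    have ne: "u i \<noteq> u j" using inj ij by (auto simp: inj_on_def)
    have "ideal_of (mon ` (?G - {u j})) = ideal_of (mon ` ?G :: ('n, 'k) mpoly set)"
    proof (rule set_eqI)
      fix p :: "('n, 'k) mpoly"
      have "(\<exists>s\<in>?G - {u j}. mle s t) \<longleftrightarrow> (\<exists>s\<in>?G. mle s t)" for t
      proof
        assume "\<exists>s\<in>?G. mle s t"
        then obtain s where s: "s \<in> ?G" "mle s t" by blast
        show "\<exists>s\<in>?G - {u j}. mle s t"
        proof (cases "s = u j")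
          case True
          then have "mle (u i) t" using le s(2) mle_trans by blast
          then show ?thesis using ij ne by blast
        qed (use s in blast)
      qed blast
      then show "p \<in> ideal_of (mon ` (?G - {u j})) \<longleftrightarrow> p \<in> ideal_of (mon ` ?G)"
        unfolding in_ideal_of_mon_iff by simp
    qed
    moreover have "?G - {u j} \<subset> ?G" using ij by blast
    ultimately show False using min gen by metis
  qed
  have nth: "?fs ! k = mon (u (Suc k))" if "k < q" for k
    using that by (simp del: upt_Suc)
  have take: "set (take k ?fs) = mon ` u ` {1..k}" if "k \<le> q" for k
  proof -
    have "take k [1..<q+1] = [1..<1+k]" using that by (intro take_upt) simp
    then show ?thesis
      by (simp only: take_map set_map set_upt image_image) (auto simp: atLeastLessThanSuc_atLeastAtMost)
  qed
  have coprime: "Poly_Mapping.lookup (u i) x = 0 \<or> Poly_Mapping.lookup (u j) x = 0"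
    if ij: "1 \<le> i" "i < j" "j \<le> q" for i j x
  proof -
    let ?g = "mgcd (u i) (u j)"
    have le: "mle (u i) (u i - ?g + u j)"
      unfolding mle_def by (simp add: lookup_add lookup_minus lookup_mgcd min_def)
    have nth_j: "?fs ! (j - 1) = mon (u j)" using nth[of "j - 1"] ij by simp
    have take_j: "set (take (j - 1) ?fs) = mon ` u ` {1..j - 1}" using ij by (intro take) simp
    have "i \<in> {1..j - 1}" using ij by simp
    then have "mon (u i - ?g) * ?fs ! (j - 1) \<in> ideal_of (set (take (j - 1) ?fs))"
      unfolding nth_j take_j mon_mult mon_in_ideal_of_mon_iff using le by blast
    moreover have "j - 1 < length ?fs" using ij by simp
    moreover note reg[unfolded regular_sequence_def]
    ultimately have "mon (u i - ?g) \<in> ideal_of (set (take (j - 1) ?fs))" by blast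
    then have "mon (u i - ?g) \<in> ideal_of (mon ` u ` {1..j - 1} :: ('n, 'k) mpoly set)"
      unfolding take_j .
    then obtain l where l: "1 \<le> l" "l \<le> j - 1" "mle (u l) (u i - ?g)"
      by (auto simp: mon_in_ideal_of_mon_iff)
    then have "mle (u l) (u i)" using diff_mle mle_trans by blast
    then have "l = i" using minimal[of l i] l ij by force
    then have "mle (u i) (u i - ?g)" using l by simp
    then have "Poly_Mapping.lookup (u i) x \<le> Poly_Mapping.lookup (u i) x - min (Poly_Mapping.lookup (u i) x) (Poly_Mapping.lookup (u j) x)"
      by (simp add: mle_def lookup_minus lookup_mgcd)
    then show ?thesis by linarith
  qed
  show ?thesis
  proof
    fix i j x assume "i \<in> {1..q}" "j \<in> {1..q}" "i \<noteq> j"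
    then show "Poly_Mapping.lookup (u i) x = 0 \<or> Poly_Mapping.lookup (u j) x = 0"
      using coprime[of i j x] coprime[of j i x] by (cases "i < j") auto
  qed (use minimal in auto)
qed

context monomial_aci
begin

text \<open>At a variable of u_j no generator in \<sigma> other than u_{q+1} has a positive
  exponent. Dividing the lcm would therefore mean dividing u_{q+1}, against minimality.\<close>

lemma generator_not_mle_flcm:
  assumes \<sigma>: "\<sigma> \<subseteq> {1..q+1}" and j: "j \<in> {1..q}" "j \<notin> \<sigma>"
  shows "\<not> mle (u j) (flcm u \<sigma>)"
proof
  assume le: "mle (u j) (flcm u \<sigma>)"
  have fin: "finite \<sigma>" using \<sigma> finite_subset by blast
  have w: "Poly_Mapping.lookup (u j) x \<le> Poly_Mapping.lookup (u (q+1)) x"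
    if nz: "0 < Poly_Mapping.lookup (u j) x" for x
  proof -
    have "Poly_Mapping.lookup (u j) x \<le> Poly_Mapping.lookup (flcm u \<sigma>) x" using le by (simp add: mle_def)
    then obtain i where i: "i \<in> \<sigma>" "Poly_Mapping.lookup (u j) x \<le> Poly_Mapping.lookup (u i) x"
      using le_lookup_mlcm_iff[of "u ` \<sigma>" _ x] fin nz by auto
    have "i = q + 1"
    proof (rule ccontr)
      assume "i \<noteq> q + 1"
      then have "i \<in> {1..q}" "i \<noteq> j" using i(1) \<sigma> j by auto
      then show False using coprime[of i j x] i(2) nz j by auto
    qed
    then show ?thesis using i by simp
  qed
  have "mle (u j) (u (q+1))" unfolding mle_def using w by (metis le0 gr0I)
  then show False using minimal[of j "q+1"] j by auto
qed

text \<open>At the variables of u_j the lcm of \<sigma> has the exponent of u_{q+1}, by coprimality.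
  Taking the maximum with u_j there adds exactly u_j / gcd(u_j, u_{q+1}).\<close>

lemma mdeg_flcm_insert:
  assumes \<sigma>: "\<sigma> \<subseteq> {1..q+1}" "q + 1 \<in> \<sigma>" and j: "j \<in> {1..q}" "j \<notin> \<sigma>"
  shows "mdeg (flcm u (insert j \<sigma>)) = mdeg (flcm u \<sigma>) + mdeg (u j - mgcd (u j) (u (q+1)))"
proof -
  have fin: "finite \<sigma>" using \<sigma> finite_subset by blast
  have "flcm u (insert j \<sigma>) = flcm u \<sigma> + (u j - mgcd (u j) (u (q+1)))"
  proof (rule poly_mapping_eqI)
    fix x
    let ?l = "\<lambda>t :: 'n monomial. Poly_Mapping.lookup t x"
    have "?l (flcm u \<sigma>) = ?l (u (q+1))" if nz: "0 < ?l (u j)"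
    proof (rule antisym)
      have "?l (u i) \<le> ?l (u (q+1))" if "i \<in> \<sigma>" for i
        using coprime[of i j x] that \<sigma>(1) j nz by (cases "i = q + 1") force+
      then show "?l (flcm u \<sigma>) \<le> ?l (u (q+1))" using fin by (auto simp: lookup_mlcm_le_iff)
      have "mle (u (q+1)) (flcm u \<sigma>)" using fin \<sigma> by (intro mle_mlcm) auto
      then show "?l (u (q+1)) \<le> ?l (flcm u \<sigma>)" by (simp add: mle_def)
    qed
    then show "?l (flcm u (insert j \<sigma>)) = ?l (flcm u \<sigma> + (u j - mgcd (u j) (u (q+1))))"
      using fin by (cases "?l (u j) = 0") (auto simp: lookup_mlcm_insert lookup_add lookup_minus lookup_mgcd max_def min_def)
  qed
  then show ?thesis by (simp only: mdeg_add)
qed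

text \<open>The set is built up starting from u_{q+1}, since \<open>mdeg_flcm_insert\<close>
  requires it to be present.\<close>

lemma mdeg_flcm_all:
  "mdeg (flcm u {1..q+1}) = mdeg (u (q+1)) + (\<Sum>j\<in>{1..q}. mdeg (u j - mgcd (u j) (u (q+1))))"
proof -
  have "mdeg (flcm u (insert (q+1) A)) = mdeg (u (q+1)) + (\<Sum>j\<in>A. mdeg (u j - mgcd (u j) (u (q+1))))"
    if "finite A" "A \<subseteq> {1..q}" for A
    using that
  proof (induction A rule: finite_induct)
    case empty
    have "flcm u {q+1} = u (q+1)"
      by (rule poly_mapping_eqI) (simp add: lookup_mlcm_insert)
    then show ?case by simp
  next
    case (insert j A)
    have "mdeg (flcm u (insert j (insert (q+1) A)))
        = mdeg (flcm u (insert (q+1) A)) + mdeg (u j - mgcd (u j) (u (q+1)))"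
      using insert by (intro mdeg_flcm_insert) auto
    then show ?case using insert by (simp add: insert_commute del: image_insert)
  qed
  from this[of "{1..q}"] show ?thesis by (simp add: atLeastAtMostSuc_conv del: image_insert)
qed

text \<open>No lcm is ever repeated, so the Taylor complex on \<open>V\<close> is minimal and every
  subset survives. It covers both I', where \<open>strict\<close> is vacuous, and case (2).\<close>

lemma reg_minimal_taylor:
  assumes V: "V \<subseteq> {1..q+1}" "V \<noteq> {}"
    and strict: "\<And>\<sigma>. \<sigma> \<subseteq> V - {q+1} \<Longrightarrow> q + 1 \<in> V \<Longrightarrow> \<not> mle (u (q+1)) (flcm u \<sigma>)"
  shows "reg (ideal_of (mon ` u ` V) :: ('n, 'k::field) mpoly set) = int (mdeg (flcm u V)) - int (card V) + 1"
proof -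
  have fin: "finite V" using V finite_subset by blast
  have crit: "flcm u (insert j \<sigma>) \<noteq> flcm u \<sigma>" if "\<sigma> \<subseteq> V" "j \<in> V - \<sigma>" for \<sigma> j
  proof -
    have "\<not> mle (u j) (flcm u \<sigma>)"
    proof (cases "j = q + 1")
      case True
      then have "\<sigma> \<subseteq> V - {q+1}" "q + 1 \<in> V" using that by auto
      then show ?thesis unfolding True by (rule strict)
    next
      case False
      then show ?thesis using that V by (intro generator_not_mle_flcm) auto
    qed
    moreover have "finite (u ` \<sigma>)" using that fin finite_subset by blast
    ultimately show ?thesis by (simp add: mlcm_insert_eq_iff)
  qed
  let ?f = "\<lambda>\<tau>. int (mdeg (flcm u \<tau>)) - int (card \<tau>) + 1"
  \<comment> \<open>With \<open>Q\<close> constantly false any vertex may play the part of p; 0 is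
    taken.\<close>
  have "reg (ideal_of (mon ` u ` V) :: ('n, 'k) mpoly set) = Max (?f ` {\<tau>. \<tau> \<subseteq> V \<and> \<tau> \<noteq> {} \<and> \<not> False})"
    by (rule reg_from_taylor[of V u 0 "\<lambda>_. False"]) (use fin crit in auto)
  also have "\<dots> = ?f V"
  proof (rule Max_eqI)
    fix x assume "x \<in> ?f ` {\<tau>. \<tau> \<subseteq> V \<and> \<tau> \<noteq> {} \<and> \<not> False}"
    then obtain \<tau> where \<tau>: "\<tau> \<subseteq> V" "x = ?f \<tau>" by auto
    have "mdeg (flcm u \<tau>) + card V \<le> mdeg (flcm u V) + card \<tau>"
      using fin \<tau>(1) by (rule mdeg_diff_card_mono) (use crit in auto)
    then show "x \<le> ?f V" using \<tau>(2) by linarith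
  qed (use fin V in auto)
  finally show ?thesis .
qed

lemma reg_complete_intersection:
  assumes "1 \<le> q"
  shows "reg (ideal_of (mon ` u ` {1..q}) :: ('n, 'k::field) mpoly set)
    = int (mdeg (flcm u {1..q})) - int q + 1"
  using reg_minimal_taylor[of "{1..q}"] assms by auto

lemma reg_of_dividing:
  assumes s: "2 \<le> s" "s \<le> q" and dvd: "mle (u (q+1)) (flcm u {1..s})"
    and min: "\<And>\<sigma>. \<sigma> \<subset> {1..s} \<Longrightarrow> \<not> mle (u (q+1)) (flcm u \<sigma>)"
  shows "reg (ideal_of (mon ` u ` {1..q+1}) :: ('n, 'k::field) mpoly set)
    = reg (ideal_of (mon ` u ` {1..q}) :: ('n, 'k) mpoly set)
      - int (Min ((\<lambda>j. mdeg (u j - mgcd (u j) (u (q+1)))) ` {1..s}))"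
proof -
  let ?V = "{1..q+1}" and ?Q = "\<lambda>\<sigma>. {1..s} \<subseteq> \<sigma>" and ?w = "u (q+1)"
  let ?d = "\<lambda>j. mdeg (u j - mgcd (u j) ?w)"
  let ?f = "\<lambda>\<tau>. int (mdeg (flcm u \<tau>)) - int (card \<tau>) + 1"
  have w: "mle ?w (flcm u \<sigma>) \<longleftrightarrow> ?Q \<sigma>" if \<sigma>: "\<sigma> \<subseteq> {1..q}" for \<sigma>
  proof
    have fin: "finite \<sigma>" using \<sigma> finite_subset by blast
    show "mle ?w (flcm u \<sigma>)" if "?Q \<sigma>"
      using that fin by (intro mle_trans[OF dvd] mlcm_mono) auto
    assume le: "mle ?w (flcm u \<sigma>)"
    \<comment> \<open>A positive exponent of u_{q+1} is reached by some u_i with i in \<sigma> and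
      by some u_k with k \<le> s; coprimality makes them equal. So \<sigma> \<inter> {1..s}
      suffices, and by minimality of {1..s} it is all of it.\<close>
    have "mle ?w (flcm u (\<sigma> \<inter> {1..s}))" unfolding mle_def
    proof
      fix x
      let ?l = "\<lambda>t :: 'n monomial. Poly_Mapping.lookup t x"
      show "?l ?w \<le> ?l (flcm u (\<sigma> \<inter> {1..s}))"
      proof (cases "?l ?w = 0")
        case False
        then have pos: "0 < ?l ?w" by simp
        have "?l ?w \<le> ?l (flcm u \<sigma>)" "?l ?w \<le> ?l (flcm u {1..s})" using le dvd by (auto simp: mle_def)
        then obtain i k where ik: "i \<in> \<sigma>" "?l ?w \<le> ?l (u i)" "k \<in> {1..s}" "?l ?w \<le> ?l (u k)"
          using fin pos by (auto simp: le_lookup_mlcm_iff)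
        then have "i \<in> {1..q}" "k \<in> {1..q}" using \<sigma> s by auto
        then have "i = k" using coprime[of i k x] ik pos by linarith
        then show ?thesis using ik fin pos by (auto simp: le_lookup_mlcm_iff)
      qed simp
    qed
    then show "?Q \<sigma>" using min[of "\<sigma> \<inter> {1..s}"] by blast
  qed
  have crit: "flcm u (insert j \<sigma>) = flcm u \<sigma> \<longleftrightarrow> j = q + 1 \<and> ?Q \<sigma>" if "\<sigma> \<subseteq> ?V" "j \<in> ?V - \<sigma>" for \<sigma> j
  proof -
    have "finite (u ` \<sigma>)" using that finite_subset by blast
    then have "flcm u (insert j \<sigma>) = flcm u \<sigma> \<longleftrightarrow> mle (u j) (flcm u \<sigma>)" by (simp add: mlcm_insert_eq_iff)
    also have "\<dots> \<longleftrightarrow> j = q + 1 \<and> ?Q \<sigma>"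
    proof (cases "j = q + 1")
      case True
      moreover have "\<sigma> \<subseteq> {1..q}"
      proof -
        have "\<sigma> \<subseteq> {1..q+1} - {q+1}" using that True by blast
        also have "\<dots> = {1..q}" by auto
        finally show ?thesis .
      qed
      ultimately show ?thesis using w by simp
    next
      case False
      then show ?thesis using that generator_not_mle_flcm[of \<sigma> j] by auto
    qed
    finally show ?thesis .
  qed
  have all: "flcm u ?V = flcm u {1..q}"
  proof -
    have "?V = insert (q+1) {1..q}" by auto
    moreover have "flcm u (insert (q+1) {1..q}) = flcm u {1..q}" using s by (subst crit) auto
    ultimately show ?thesis by simp
  qed
  \<comment> \<open>The candidates for the maximum: u_{q+1} stays, so restoring u_j changes the
    degree by \<open>?d j\<close>.\<close>
  have drop: "?f (?V - {j}) = int (mdeg (flcm u {1..q})) - int (?d j) - int q + 1" if j: "j \<in> {1..s}" for j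
  proof -
    have V: "insert j (?V - {j}) = ?V" "card (?V - {j}) = q" using j s by auto
    have "mdeg (flcm u (insert j (?V - {j}))) = mdeg (flcm u (?V - {j})) + ?d j"
      by (rule mdeg_flcm_insert) (use j s in auto)
    then show ?thesis unfolding V(1) all V(2) by linarith
  qed
  have fin: "finite {\<tau>. \<tau> \<subseteq> ?V \<and> \<tau> \<noteq> {} \<and> \<not> ?Q (\<tau> - {q+1})}" by simp
  have "reg (ideal_of (mon ` u ` ?V) :: ('n, 'k) mpoly set)
      = Max (?f ` {\<tau>. \<tau> \<subseteq> ?V \<and> \<tau> \<noteq> {} \<and> \<not> ?Q (\<tau> - {q+1})})"
    using finite_atLeastAtMost crit
  proof (rule reg_from_taylor[of ?V u "q + 1" ?Q])
    show "q + 1 \<in> ?V" by simp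
    show "\<not> ?Q {}" using s by simp
  qed
  also have "\<dots> = int (mdeg (flcm u {1..q})) - int (Min (?d ` {1..s})) - int q + 1" (is "_ = ?m")
  proof (rule Max_eqI)
    fix x assume "x \<in> ?f ` {\<tau>. \<tau> \<subseteq> ?V \<and> \<tau> \<noteq> {} \<and> \<not> ?Q (\<tau> - {q+1})}"
    then obtain \<tau> where \<tau>: "\<tau> \<subseteq> ?V" "x = ?f \<tau>" "\<not> ?Q (\<tau> - {q+1})" by blast
    moreover have "q + 1 \<notin> {1..s}" using s by simp
    ultimately obtain j where j: "j \<in> {1..s}" "j \<notin> \<tau>" by blast
    \<comment> \<open>Every set between \<tau> and ?V - {j} misses j \<le> s, so no step in between
      leaves the lcm unchanged.\<close>
    have "mdeg (flcm u \<tau>) + card (?V - {j}) \<le> mdeg (flcm u (?V - {j})) + card \<tau>"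
    proof (rule mdeg_diff_card_mono)
      show "\<tau> \<subseteq> ?V - {j}" using \<tau>(1) j(2) by blast
      fix \<sigma> i assume "insert i \<sigma> \<subseteq> ?V - {j}" "i \<notin> \<sigma>"
      then show "flcm u (insert i \<sigma>) \<noteq> flcm u \<sigma>" using crit[of \<sigma> i] j(1) by blast
    qed simp
    then have "x \<le> ?f (?V - {j})" using \<tau>(2) by linarith
    moreover have "Min (?d ` {1..s}) \<le> ?d j" using j(1) by (intro Min_le) auto
    ultimately show "x \<le> ?m" unfolding drop[OF j(1)] by linarith
  next
    have "Min (?d ` {1..s}) \<in> ?d ` {1..s}" using s by (intro Min_in) auto
    then obtain j where j: "j \<in> {1..s}" "Min (?d ` {1..s}) = ?d j" by blast
    have "q + 1 \<in> ?V - {j}" using j s by simp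
    then have "?V - {j} \<in> {\<tau>. \<tau> \<subseteq> ?V \<and> \<tau> \<noteq> {} \<and> \<not> ?Q (\<tau> - {q+1})}" using j by blast
    moreover have "?m = ?f (?V - {j})" unfolding drop[OF j(1)] j(2) ..
    ultimately show "?m \<in> ?f ` {\<tau>. \<tau> \<subseteq> ?V \<and> \<tau> \<noteq> {} \<and> \<not> ?Q (\<tau> - {q+1})}" by (rule rev_image_eqI)
  qed (use fin in blast)
  also have "\<dots> = reg (ideal_of (mon ` u ` {1..q}) :: ('n, 'k) mpoly set) - int (Min (?d ` {1..s}))"
    using s by (subst reg_complete_intersection) auto
  finally show ?thesis .
qed

text \<open>All q + 1 generators together attain the maximum. The degree of their lcm is the total
  degree minus the degrees of the gcds with u_{q+1}, and these gcds are 1 beyond h.\<close>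

lemma reg_of_not_dividing:
  assumes h: "h \<le> q"
    and ndvd: "\<And>\<sigma>. \<sigma> \<subseteq> {1..q} \<Longrightarrow> \<not> mle (u (q+1)) (flcm u \<sigma>)"
    and supp: "\<And>j. j \<in> {1..q} \<Longrightarrow> Poly_Mapping.keys (u j) \<inter> Poly_Mapping.keys (u (q+1)) \<noteq> {} \<longleftrightarrow> j \<le> h"
  shows "reg (ideal_of (mon ` u ` {1..q+1}) :: ('n, 'k::field) mpoly set)
    = (\<Sum>l=1..q+1. int (mdeg (u l))) - int q - (\<Sum>i=1..h. int (mdeg (mgcd (u i) (u (q+1)))))"
proof -
  let ?w = "u (q+1)"
  have gcd0: "mgcd (u j) ?w = 0" if "j \<in> {1..q} - {1..h}" for j
  proof -
    have "Poly_Mapping.keys (u j) \<inter> Poly_Mapping.keys ?w = {}" using supp[of j] that by auto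
    then have "Poly_Mapping.lookup (u j) x = 0 \<or> Poly_Mapping.lookup ?w x = 0" for x
      by (auto simp: in_keys_iff disjoint_iff)
    then show ?thesis by (intro poly_mapping_eqI) (metis lookup_mgcd lookup_zero min_0L min_0R)
  qed
  have "reg (ideal_of (mon ` u ` {1..q+1}) :: ('n, 'k) mpoly set) = int (mdeg (flcm u {1..q+1})) - int q"
  proof -
    have "{1..q+1} - {q+1} = {1..q}" by auto
    then show ?thesis using reg_minimal_taylor[of "{1..q+1}", where 'k = 'k] ndvd by simp
  qed
  also have "int (mdeg (flcm u {1..q+1}))
      = int (mdeg ?w) + (\<Sum>j\<in>{1..q}. int (mdeg (u j - mgcd (u j) ?w)))"
    unfolding mdeg_flcm_all by simp
  also have "(\<Sum>j\<in>{1..q}. int (mdeg (u j - mgcd (u j) ?w)))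
      = (\<Sum>j\<in>{1..q}. int (mdeg (u j))) - (\<Sum>j\<in>{1..q}. int (mdeg (mgcd (u j) ?w)))"
    unfolding sum_subtractf[symmetric]
    by (intro sum.cong refl) (simp add: mdeg_diff[OF mgcd_mle] of_nat_diff mdeg_mono[OF mgcd_mle])
  also have "(\<Sum>j\<in>{1..q}. int (mdeg (mgcd (u j) ?w))) = (\<Sum>j\<in>{1..h}. int (mdeg (mgcd (u j) ?w)))"
    using h gcd0 by (intro sum.mono_neutral_right) auto
  finally show ?thesis by simp
qed

end

theorem theorem1p6:
  fixes I I' :: "('n::finite, 'k::field) mpoly set"
    and u :: "nat \<Rightarrow> 'n monomial"
    and q :: nat
  assumes aci: "almost_complete_intersection I q u"
    and I': "I' = ideal_of (mon ` u ` {1..q})"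
  shows
    "(\<forall>s. 2 \<le> s \<and> s \<le> q
         \<and> (mon (u (q+1)) :: ('n, 'k) mpoly) dvd mon (mlcm (u ` {1..s}))
         \<and> (\<forall>\<sigma>. \<sigma> \<subseteq> u ` {1..s} \<and> card \<sigma> < s
               \<longrightarrow> \<not> (mon (u (q+1)) :: ('n, 'k) mpoly) dvd mon (mlcm \<sigma>))
       \<longrightarrow> reg I = reg I' - int (Min ((\<lambda>j. mdeg (u j - mgcd (u j) (u (q+1)))) ` {1..s})))
     \<and>
     ((\<forall>\<sigma>. \<sigma> \<subseteq> u ` {1..q+1} - {u (q+1)}
           \<longrightarrow> \<not> (mon (u (q+1)) :: ('n, 'k) mpoly) dvd mon (mlcm \<sigma>))
       \<longrightarrow> (\<forall>h. 1 \<le> h \<and> h \<le> q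
             \<and> (\<forall>j\<in>{1..q}. Poly_Mapping.keys (u j) \<inter> Poly_Mapping.keys (u (q+1)) \<noteq> {} \<longleftrightarrow> j \<le> h)
           \<longrightarrow> reg I = (\<Sum>l=1..q+1. int (mdeg (u l))) - int q
                      - (\<Sum>i=1..h. int (mdeg (mgcd (u i) (u (q+1)))))))"
proof -
  interpret monomial_aci u q by (rule monomial_aciI[OF aci])
  have I: "I = ideal_of (mon ` u ` {1..q+1})" and inj: "inj_on u {1..q+1}"
    using aci by (auto simp: almost_complete_intersection_def minimal_monomial_generators_def)
  show ?thesis unfolding mon_dvd_mon_iff
  proof (intro conjI allI impI; elim conjE)
    fix s assume s: "2 \<le> s" "s \<le> q" "mle (u (q+1)) (flcm u {1..s})"
      and min: "\<forall>\<sigma>. \<sigma> \<subseteq> u ` {1..s} \<and> card \<sigma> < s \<longrightarrow> \<not> mle (u (q+1)) (mlcm \<sigma>)"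
    have "\<not> mle (u (q+1)) (flcm u \<sigma>)" if \<sigma>: "\<sigma> \<subset> {1..s}" for \<sigma>
    proof -
      \<comment> \<open>The theorem bounds the size of a set of monomials, the lemma speaks of
        proper index subsets; taking images does not enlarge a set.\<close>
      have "card (u ` \<sigma>) < s"
        using card_image_le[of \<sigma> u] psubset_card_mono[OF _ \<sigma>] finite_subset[of \<sigma> "{1..s}"] \<sigma> by force
      then show ?thesis using min \<sigma> by (simp add: image_mono psubset_imp_subset)
    qed
    then show "reg I = reg I' - int (Min ((\<lambda>j. mdeg (u j - mgcd (u j) (u (q+1)))) ` {1..s}))"
      unfolding I I' using s by (intro reg_of_dividing) auto
  next
    fix h assume nd: "\<forall>\<sigma>\<subseteq>u ` {1..q+1} - {u (q+1)}. \<not> mle (u (q+1)) (mlcm \<sigma>)"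
      and h: "1 \<le> h" "h \<le> q"
        "\<forall>j\<in>{1..q}. Poly_Mapping.keys (u j) \<inter> Poly_Mapping.keys (u (q+1)) \<noteq> {} \<longleftrightarrow> j \<le> h"
    \<comment> \<open>Injectivity of u keeps u_{q+1} out of the image of the indices up to
      q.\<close>
    have "u ` \<sigma> \<subseteq> u ` {1..q+1} - {u (q+1)}" if "\<sigma> \<subseteq> {1..q}" for \<sigma>
      using that inj by (fastforce simp: inj_on_def)
    then show "reg I = (\<Sum>l=1..q+1. int (mdeg (u l))) - int q - (\<Sum>i=1..h. int (mdeg (mgcd (u i) (u (q+1)))))"
      unfolding I using h nd by (intro reg_of_not_dividing) auto
  qed
qed

end
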